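(* Assume: there is $L>0$ with $|f_i(x,a)-f_i(y,a)|\le L|x-y|$ for $i=\pm1$, all $a\in A$ and all admissible $x,y$; for each $i=\pm1$ there are $a_i^-,a_i^+\in A$ with $f_i(0,a_i^-)<0<f_i(0,a_i^+)$; and there is a continuous increasing $\omega_\ell:[0,\infty)\to[0,\infty)$ with $\omega_\ell(0)=0$ and $|\ell_i(x,a)-\ell_i(y,a)|\le\omega_\ell(|x-y|)$ for all such $i,a,x,y$. Let $\tilde V:\mathbb{R}\to\mathbb{R}$ be the limit, as $\varepsilon\to0^+$, of the thermostatic value functions (see context). Then $\tilde V$ is a viscosity solution of the Hamilton-Jacobi-Bellman problem $$\begin{cases}\lambda V+H_1(x,V')=0 & \text{in } \{x>0\},\\ \lambda V+H_{-1}(x,V')=0 & \text{in } \{x<0\},\\ \min\{\lambda V+H_1,\ \lambda V+H_{-1}\}\le0 & \text{on } x=0,\\ \max\{\lambda V+H_1,\ \lambda V+H_{-1}\}\ge0 & \text{on } x=0,\end{cases}$$ meaning that $\tilde V$ is a viscosity subsolution of the first three relations and a viscosity supersolution of the first two together with the fourth.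
   Context: Data. $A$ is a compact control set, $\lambda>0$, and $\mathcal{A}$ is the set of measurable controls $\alpha:[0,+\infty)\to A$. Branch $1$ is $[0,+\infty)$ and branch $-1$ is $(-\infty,0]$. The dynamics $f_1:[0,+\infty)\times A\to\mathbb{R}$, $f_{-1}:(-\infty,0]\times A\to\mathbb{R}$ and the running costs $\ell_1:[0,+\infty)\times A\to[0,+\infty)$, $\ell_{-1}:(-\infty,0]\times A\to[0,+\infty)$ are continuous and bounded. For $\varepsilon>0$, $f_1,\ell_1$ are extended to $[-\varepsilon,+\infty)\times A$ and $f_{-1},\ell_{-1}$ to $(-\infty,\varepsilon]\times A$ by constancy in $x$. Delayed thermostat. For a continuous scalar input $u$ and an initial output $i_0\in\{-1,1\}$ coherent with $u(0)$ ($i_0=1$ if $u(0)>\varepsilon$, $i_0=-1$ if $u(0)<-\varepsilon$), $h_\varepsilon[u](t)\in\{-1,1\}$ is the unique output with initial value $i_0$ such that: it jumps from $1$ to $-1$ when, and only when, $u$, coming from values $\ge-\varepsilon$, goes below $-\varepsilon$; it jumps from $-1$ to $1$ when, and only when, $u$, coming from values $\le\varepsilon$, goes above $\varepsilon$; otherwise it stays constant. Approximating problem. For $(x_0,i_0)\in([-\varepsilon,+\infty)\times\{1\})\cup((-\infty,\varepsilon]\times\{-1\})$ and $\alpha\in\mathcal A$ let $(x(t),i(t))$ solve $x'(t)=f_{i(t)}(x(t),\alpha(t))$, $i(t)=h_\varepsilon[x](t)$, $x(0)=x_0$, $i(0)=i_0$, and put $$V_\varepsilon(x_0,i_0)=\inf_{\alpha\in\mathcal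 A}\int_0^\infty e^{-\lambda t}\ell_{i(t)}(x(t),\alpha(t))\,dt.$$ Let $\tilde V_\varepsilon(x)=V_\varepsilon(x,1)$ for $x>0$ and $\tilde V_\varepsilon(x)=V_\varepsilon(x,-1)$ for $x<0$. Under the assumptions of the claim, $\tilde V_\varepsilon$ converges uniformly on $\mathbb{R}\setminus\{0\}$ as $\varepsilon\to0^+$, and the limit extends continuously to $\mathbb{R}$; $\tilde V$ denotes this extension. Hamiltonians: $H_i(x,p)=\sup_{a\in A}\{-f_i(x,a)p-\ell_i(x,a)\}$, $i=\pm1$. Junction conditions. The third relation for a continuous $u$ means: for every $\varphi\in C^1(\mathbb{R})$ such that $u-\varphi$ has a local maximum at $0$, $\min\{\lambda u(0)+H_1(0,\varphi'(0)),\lambda u(0)+H_{-1}(0,\varphi'(0))\}\le0$. The fourth means: for every $\varphi\in C^1(\mathbb{R})$ such that $u-\varphi$ has a local minimum at $0$, $\max\{\lambda u(0)+H_1(0,\varphi'(0)),\lambda u(0)+H_{-1}(0,\varphi'(0))\}\ge0$. The first two equations are understood in the usual viscosity sense on open half-lines. *)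

theory Defs
  imports "HOL-Analysis.Analysis"
begin

text \<open>
  The branch index ranges over the integers \<open>1\<close> and \<open>-1\<close>; data of other indices are never used.
\<close>

definition branch :: "int \<Rightarrow> real set" where
  "branch i = (if i = 1 then {0..} else {..0})"

text \<open>
  Extension of data on a branch by constancy in \<open>x\<close>. It is defined on the whole line, but along
  solutions only the \<open>\<epsilon>\<close>-neighbourhood of the branch is visited.
\<close>

definition const_ext :: "(int \<Rightarrow> real \<Rightarrow> 'a \<Rightarrow> real) \<Rightarrow> int \<Rightarrow> real \<Rightarrow> 'a \<Rightarrow> real" where
  "const_ext g i x a = g i (if i = 1 then max x 0 else min x 0) a"

definition controls :: "'a::metric_space set \<Rightarrow> (real \<Rightarrow> 'a) set" where
  "controls A = {\<alpha>. \<alpha> \<in> borel_measurable (lebesgue_on {0..}) \<and> (\<forall>t\<ge>0. \<alpha> t \<in> A)}"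

text \<open>
  \<open>thermostat \<epsilon> u i\<^sub>0 i\<close> says that on \<open>[0, \<infinity>)\<close> the output \<open>i\<close> is \<open>h\<^sub>\<epsilon>[u]\<close> with initial value \<open>i\<^sub>0\<close>.
  The lines about a value of \<open>u\<close> beyond a threshold are the ``when'' of the switching rule, the
  lines about two times \<open>s < t\<close> the ``only when'' (and hence that \<open>i\<close> is constant otherwise).
  The output at a switching instant itself, where \<open>u\<close> still sits on the threshold, is the old one.
\<close>

definition thermostat :: "real \<Rightarrow> (real \<Rightarrow> real) \<Rightarrow> int \<Rightarrow> (real \<Rightarrow> int) \<Rightarrow> bool" where
  "thermostat \<epsilon> u i\<^sub>0 i \<longleftrightarrow>
     i 0 = i\<^sub>0 \<and>
     (\<forall>t\<ge>0. i t \<in> {1, -1}) \<and>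
     (\<forall>t\<ge>0. u t < -\<epsilon> \<longrightarrow> i t = -1) \<and>
     (\<forall>t\<ge>0. u t > \<epsilon> \<longrightarrow> i t = 1) \<and>
     (\<forall>s\<ge>0. \<forall>t>s. i s = 1 \<and> i t = -1 \<longrightarrow> (\<exists>r\<in>{s<..t}. u r < -\<epsilon>)) \<and>
     (\<forall>s\<ge>0. \<forall>t>s. i s = -1 \<and> i t = 1 \<longrightarrow> (\<exists>r\<in>{s<..t}. u r > \<epsilon>))"

lemma thermostat_exists:
  assumes "\<epsilon> > 0" "i\<^sub>0 \<in> {1, -1}" "u 0 > \<epsilon> \<longrightarrow> i\<^sub>0 = 1" "u 0 < -\<epsilon> \<longrightarrow> i\<^sub>0 = -1"
  shows "\<exists>i. thermostat \<epsilon> u i\<^sub>0 i"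
proof -
  define P where "P t \<longleftrightarrow> (\<exists>s\<in>{0..t}. u s > \<epsilon> \<and> (\<forall>r\<in>{s..t}. u r \<ge> -\<epsilon>))
      \<or> (i\<^sub>0 = 1 \<and> (\<forall>r\<in>{0..t}. u r \<ge> -\<epsilon>))" for t
  define i where "i t = (if P t then 1 else -1 :: int)" for t
  have 0: "P 0 \<longleftrightarrow> i\<^sub>0 = 1"
    using assms unfolding P_def by fastforce
  have 1: "\<not> P t" if "t \<ge> 0" "u t < -\<epsilon>" for t
    using that unfolding P_def by (meson atLeastAtMost_iff not_le order_refl)
  have 2: "P t" if "t \<ge> 0" "u t > \<epsilon>" for t
    unfolding P_def using that assms(1) by (intro disjI1 bexI[of _ t]) auto
  have 3: "\<exists>r\<in>{s<..t}. u r < -\<epsilon>" if "s \<ge> 0" "t > s" "P s" "\<not> P t" for s t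
  proof (rule ccontr)
    assume n: "\<not> ?thesis"
    have "P t" using \<open>P s\<close> unfolding P_def
    proof
      assume "\<exists>s'\<in>{0..s}. u s' > \<epsilon> \<and> (\<forall>r\<in>{s'..s}. u r \<ge> -\<epsilon>)"
      then obtain s' where s': "s' \<in> {0..s}" "u s' > \<epsilon>" "\<forall>r\<in>{s'..s}. u r \<ge> -\<epsilon>" by blast
      have "\<forall>r\<in>{s'..t}. u r \<ge> -\<epsilon>" using s' n by (metis atLeastAtMost_iff greaterThanAtMost_iff not_le)
      with s' \<open>t > s\<close> show "(\<exists>s\<in>{0..t}. u s > \<epsilon> \<and> (\<forall>r\<in>{s..t}. u r \<ge> -\<epsilon>))
         \<or> (i\<^sub>0 = 1 \<and> (\<forall>r\<in>{0..t}. u r \<ge> -\<epsilon>))" by (intro disjI1 bexI[of _ s']) auto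
    next
      assume "i\<^sub>0 = 1 \<and> (\<forall>r\<in>{0..s}. u r \<ge> -\<epsilon>)"
      then show "(\<exists>s\<in>{0..t}. u s > \<epsilon> \<and> (\<forall>r\<in>{s..t}. u r \<ge> -\<epsilon>))
         \<or> (i\<^sub>0 = 1 \<and> (\<forall>r\<in>{0..t}. u r \<ge> -\<epsilon>))" 
        using n by (metis atLeastAtMost_iff greaterThanAtMost_iff not_le)
    qed
    with \<open>\<not> P t\<close> show False by simp
  qed
  have 4: "\<exists>r\<in>{s<..t}. u r > \<epsilon>" if st: "s \<ge> 0" "t > s" "\<not> P s" "P t" for s t
  proof -
    have "\<not> (i\<^sub>0 = 1 \<and> (\<forall>r\<in>{0..t}. u r \<ge> -\<epsilon>))"
      using st unfolding P_def by auto
    then obtain s' where s': "s' \<in> {0..t}" "u s' > \<epsilon>" "\<forall>r\<in>{s'..t}. u r \<ge> -\<epsilon>"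
      using \<open>P t\<close> unfolding P_def by blast
    have "s' > s" 
    proof (rule ccontr)
      assume "\<not> s' > s"
      then have "P s" unfolding P_def using s' st by (intro disjI1 bexI[of _ s']) auto
      with st show False by simp
    qed
    with s' show ?thesis by auto
  qed
  have "thermostat \<epsilon> u i\<^sub>0 i"
    unfolding thermostat_def i_def using assms(2) 0 1 2 3 4 by auto
  then show ?thesis by blast
qed

lemma thermostat_unique:
  assumes "\<epsilon> > 0" "continuous_on {0..} u" "thermostat \<epsilon> u i\<^sub>0 i" "thermostat \<epsilon> u i\<^sub>0 j" "t \<ge> 0"
  shows "i t = j t"
proof (cases "\<forall>s\<in>{0..t}. \<bar>u s\<bar> \<le> \<epsilon>")
  case True
  have const: "k t = i\<^sub>0" if k: "thermostat \<epsilon> u i\<^sub>0 k" for k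
  proof (cases "t = 0")
    case True then show ?thesis using k unfolding thermostat_def by simp
  next
    case False
    then have "t > 0" using assms by simp
    moreover have "\<not> (\<exists>r\<in>{0<..t}. u r < -\<epsilon>)" "\<not> (\<exists>r\<in>{0<..t}. u r > \<epsilon>)"
      using True by (smt (verit) greaterThanAtMost_iff atLeastAtMost_iff)+
    moreover have "k 0 = i\<^sub>0" "k 0 \<in> {1,-1}" "k t \<in> {1,-1}"
      using k assms(5) unfolding thermostat_def by auto
    ultimately show ?thesis using k unfolding thermostat_def by (metis insertE order_refl singletonD)
  qed
  show ?thesis using const[OF assms(3)] const[OF assms(4)] by simp
next
  case False
  define S where "S = {s\<in>{0..t}. \<bar>u s\<bar> > \<epsilon>}"
  have ne: "S \<noteq> {}" and bdd: "bdd_above S" using False unfolding S_def by (auto intro: bdd_aboveI[of _ t])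
  define \<sigma> where "\<sigma> = Sup S"
  have \<sigma>: "\<sigma> \<in> {0..t}"
  proof -
    obtain s where "s \<in> S" using ne by blast
    then have "s \<le> \<sigma>" unfolding \<sigma>_def using bdd by (intro cSup_upper)
    moreover have "s \<ge> 0" using \<open>s \<in> S\<close> by (simp add: S_def)
    moreover have "\<sigma> \<le> t" unfolding \<sigma>_def using ne by (intro cSup_least) (auto simp: S_def)
    ultimately show ?thesis by auto
  qed
  obtain d where d: "d > 0" "\<And>r. r \<ge> 0 \<Longrightarrow> \<bar>r - \<sigma>\<bar> < d \<Longrightarrow> \<bar>u r - u \<sigma>\<bar> < \<epsilon> / 2"
    using assms(2) \<sigma> \<open>\<epsilon> > 0\<close> unfolding continuous_on_iff dist_real_def
    by (metis atLeastAtMost_iff atLeast_iff half_gt_zero)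
  obtain s where s: "s \<in> S" "s > \<sigma> - d" using less_cSupD[OF ne, of "\<sigma> - d"] d(1) unfolding \<sigma>_def by auto
  have s\<sigma>: "s \<le> \<sigma>" unfolding \<sigma>_def using s bdd by (intro cSup_upper)
  have st: "0 \<le> s" "s \<le> t" "\<bar>u s\<bar> > \<epsilon>" using s unfolding S_def by auto
  have near: "\<bar>u r - u s\<bar> < \<epsilon>" if "r \<in> {s..\<sigma>}" for r
  proof -
    have "\<bar>u r - u \<sigma>\<bar> < \<epsilon> / 2" "\<bar>u s - u \<sigma>\<bar> < \<epsilon> / 2"
      using that s st s\<sigma> by (intro d(2); simp add: abs_if)+
    then show ?thesis by linarith
  qed
  have far: "\<bar>u r\<bar> \<le> \<epsilon>" if "r \<in> {\<sigma><..t}" for r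
  proof (rule ccontr)
    assume "\<not> ?thesis"
    then have "r \<in> S" using that \<sigma> unfolding S_def by auto
    then have "r \<le> \<sigma>" unfolding \<sigma>_def using bdd by (intro cSup_upper)
    with that show False by auto
  qed
  show ?thesis
  proof (cases "u s > 0")
    case True
    then have no: "\<not> (\<exists>r\<in>{s<..t}. u r < -\<epsilon>)"
      using near far st by (smt (verit) greaterThanAtMost_iff atLeastAtMost_iff)
    have const: "k t = 1" if k: "thermostat \<epsilon> u i\<^sub>0 k" for k
    proof -
      have "k s = 1" "k t \<in> {1,-1}" using k st True assms(5) unfolding thermostat_def by auto
      then show ?thesis using k no st(1,2) unfolding thermostat_def
        by (metis insertE singletonD order_le_less)
    qed
    show ?thesis using const[OF assms(3)] const[OF assms(4)] by simp
  next
    case False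
    then have no: "\<not> (\<exists>r\<in>{s<..t}. u r > \<epsilon>)"
      using near far st by (smt (verit) greaterThanAtMost_iff atLeastAtMost_iff)
    have const: "k t = -1" if k: "thermostat \<epsilon> u i\<^sub>0 k" for k
    proof -
      have "k s = -1" "k t \<in> {1,-1}" using k st False assms(5) unfolding thermostat_def by auto
      then show ?thesis using k no st(1,2) unfolding thermostat_def
        by (metis insertE singletonD order_le_less)
    qed
    show ?thesis using const[OF assms(3)] const[OF assms(4)] by simp
  qed
qed

text \<open>
  Solutions \<open>(x, i)\<close> on \<open>[0, \<infinity>)\<close> of \<open>x' = f\<^sub>i(x, \<alpha>)\<close>, \<open>i = h\<^sub>\<epsilon>[x]\<close>, \<open>x(0) = x\<^sub>0\<close>, \<open>i(0) = i\<^sub>0\<close>, in the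
  sense of the integral equation (controls are only measurable).
\<close>

definition is_solution ::
  "(int \<Rightarrow> real \<Rightarrow> 'a \<Rightarrow> real) \<Rightarrow> real \<Rightarrow> real \<Rightarrow> int \<Rightarrow> (real \<Rightarrow> 'a) \<Rightarrow> (real \<Rightarrow> real) \<Rightarrow> (real \<Rightarrow> int) \<Rightarrow> bool"
where
  "is_solution f \<epsilon> x\<^sub>0 i\<^sub>0 \<alpha> x i \<longleftrightarrow>
     continuous_on {0..} x \<and>
     (\<forall>t\<ge>0. set_integrable lebesgue {0..t} (\<lambda>s. const_ext f (i s) (x s) (\<alpha> s)) \<and>
             x t = x\<^sub>0 + (LINT s:{0..t}|lebesgue. const_ext f (i s) (x s) (\<alpha> s))) \<and>
     thermostat \<epsilon> x i\<^sub>0 i"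

definition cost ::
  "(int \<Rightarrow> real \<Rightarrow> 'a \<Rightarrow> real) \<Rightarrow> real \<Rightarrow> (real \<Rightarrow> 'a) \<Rightarrow> (real \<Rightarrow> real) \<Rightarrow> (real \<Rightarrow> int) \<Rightarrow> real" where
  "cost l lam \<alpha> x i =
     (LINT t:{0..}|lebesgue. exp (- lam * t) * const_ext l (i t) (x t) (\<alpha> t))"

text \<open>
  The system is coupled to its own output at the thresholds (the two dynamics may point in
  opposite directions there), so a control need not have exactly one solution. The infimum is
  therefore taken over all pairs of a control and a solution.
\<close>

definition V_eps ::
  "'a::metric_space set \<Rightarrow> (int \<Rightarrow> real \<Rightarrow> 'a \<Rightarrow> real) \<Rightarrow> (int \<Rightarrow> real \<Rightarrow> 'a \<Rightarrow> real) \<Rightarrow> real \<Rightarrow> real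
    \<Rightarrow> real \<Rightarrow> int \<Rightarrow> real" where
  "V_eps A f l lam \<epsilon> x\<^sub>0 i\<^sub>0 =
     Inf {cost l lam \<alpha> x i | \<alpha> x i. \<alpha> \<in> controls A \<and> is_solution f \<epsilon> x\<^sub>0 i\<^sub>0 \<alpha> x i}"

text \<open>Only used for \<open>x \<noteq> 0\<close>.\<close>

definition V_tilde_eps ::
  "'a::metric_space set \<Rightarrow> (int \<Rightarrow> real \<Rightarrow> 'a \<Rightarrow> real) \<Rightarrow> (int \<Rightarrow> real \<Rightarrow> 'a \<Rightarrow> real) \<Rightarrow> real \<Rightarrow> real
    \<Rightarrow> real \<Rightarrow> real" where
  "V_tilde_eps A f l lam \<epsilon> x = V_eps A f l lam \<epsilon> x (if x > 0 then 1 else -1)"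

text \<open>\<open>V\<close> is the continuous extension to the line of the uniform limit of \<open>V_tilde_eps\<close> as \<open>\<epsilon> \<rightarrow> 0+\<close>.\<close>

definition is_thermostatic_limit ::
  "'a::metric_space set \<Rightarrow> (int \<Rightarrow> real \<Rightarrow> 'a \<Rightarrow> real) \<Rightarrow> (int \<Rightarrow> real \<Rightarrow> 'a \<Rightarrow> real) \<Rightarrow> real
    \<Rightarrow> (real \<Rightarrow> real) \<Rightarrow> bool" where
  "is_thermostatic_limit A f l lam V \<longleftrightarrow>
     uniform_limit (UNIV - {0}) (V_tilde_eps A f l lam) V (at_right 0) \<and> continuous_on UNIV V"

definition hamiltonian ::
  "'a set \<Rightarrow> (int \<Rightarrow> real \<Rightarrow> 'a \<Rightarrow> real) \<Rightarrow> (int \<Rightarrow> real \<Rightarrow> 'a \<Rightarrow> real) \<Rightarrow> int \<Rightarrow> real \<Rightarrow> real \<Rightarrow> real" where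
  "hamiltonian A f l i x p = (SUP a\<in>A. - f i x a * p - l i x a)"

definition local_max_at :: "(real \<Rightarrow> real) \<Rightarrow> real \<Rightarrow> bool" where
  "local_max_at g x \<longleftrightarrow> (\<forall>\<^sub>F y in nhds x. g y \<le> g x)"

definition local_min_at :: "(real \<Rightarrow> real) \<Rightarrow> real \<Rightarrow> bool" where
  "local_min_at g x \<longleftrightarrow> (\<forall>\<^sub>F y in nhds x. g x \<le> g y)"

text \<open>Viscosity sub- and supersolutions of \<open>F(x, u, u') = 0\<close> in an open set \<open>\<Omega>\<close> (\<open>u\<close> continuous).\<close>

definition viscosity_subsolution ::
  "real set \<Rightarrow> (real \<Rightarrow> real \<Rightarrow> real \<Rightarrow> real) \<Rightarrow> (real \<Rightarrow> real) \<Rightarrow> bool" where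
  "viscosity_subsolution \<Omega> F u \<longleftrightarrow>
     (\<forall>\<phi>. \<phi> C1_differentiable_on \<Omega> \<longrightarrow>
        (\<forall>x\<in>\<Omega>. local_max_at (\<lambda>y. u y - \<phi> y) x \<longrightarrow> F x (u x) (deriv \<phi> x) \<le> 0))"

definition viscosity_supersolution ::
  "real set \<Rightarrow> (real \<Rightarrow> real \<Rightarrow> real \<Rightarrow> real) \<Rightarrow> (real \<Rightarrow> real) \<Rightarrow> bool" where
  "viscosity_supersolution \<Omega> F u \<longleftrightarrow>
     (\<forall>\<phi>. \<phi> C1_differentiable_on \<Omega> \<longrightarrow>
        (\<forall>x\<in>\<Omega>. local_min_at (\<lambda>y. u y - \<phi> y) x \<longrightarrow> F x (u x) (deriv \<phi> x) \<ge> 0))"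

definition junction_subsolution ::
  "(int \<Rightarrow> real \<Rightarrow> real \<Rightarrow> real) \<Rightarrow> real \<Rightarrow> (real \<Rightarrow> real) \<Rightarrow> bool" where
  "junction_subsolution H lam u \<longleftrightarrow>
     (\<forall>\<phi>. \<phi> C1_differentiable_on UNIV \<and> local_max_at (\<lambda>y. u y - \<phi> y) 0 \<longrightarrow>
        min (lam * u 0 + H 1 0 (deriv \<phi> 0)) (lam * u 0 + H (-1) 0 (deriv \<phi> 0)) \<le> 0)"

definition junction_supersolution ::
  "(int \<Rightarrow> real \<Rightarrow> real \<Rightarrow> real) \<Rightarrow> real \<Rightarrow> (real \<Rightarrow> real) \<Rightarrow> bool" where
  "junction_supersolution H lam u \<longleftrightarrow>
     (\<forall>\<phi>. \<phi> C1_differentiable_on UNIV \<and> local_min_at (\<lambda>y. u y - \<phi> y) 0 \<longrightarrow>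
        max (lam * u 0 + H 1 0 (deriv \<phi> 0)) (lam * u 0 + H (-1) 0 (deriv \<phi> 0)) \<ge> 0)"

definition HJB_subsolution ::
  "(int \<Rightarrow> real \<Rightarrow> real \<Rightarrow> real) \<Rightarrow> real \<Rightarrow> (real \<Rightarrow> real) \<Rightarrow> bool" where
  "HJB_subsolution H lam u \<longleftrightarrow>
     viscosity_subsolution {0<..} (\<lambda>x v p. lam * v + H 1 x p) u \<and>
     viscosity_subsolution {..<0} (\<lambda>x v p. lam * v + H (-1) x p) u \<and>
     junction_subsolution H lam u"

definition HJB_supersolution ::
  "(int \<Rightarrow> real \<Rightarrow> real \<Rightarrow> real) \<Rightarrow> real \<Rightarrow> (real \<Rightarrow> real) \<Rightarrow> bool" where
  "HJB_supersolution H lam u \<longleftrightarrow>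
     viscosity_supersolution {0<..} (\<lambda>x v p. lam * v + H 1 x p) u \<and>
     viscosity_supersolution {..<0} (\<lambda>x v p. lam * v + H (-1) x p) u \<and>
     junction_supersolution H lam u"

end

theory Submission
  imports Defs
begin

text \<open>
  Write \<open>F\<^sub>i\<close>, \<open>G\<^sub>i\<close> for the dynamics and running costs extended by constancy and call a state
  \<open>(x, i)\<close> coherent if \<open>i x \<ge> -\<epsilon>\<close>. The proof rests on two dynamic programming inequalities for
  the value function \<open>V\<^sub>\<epsilon>\<close> on coherent states, valid for small \<open>\<epsilon>\<close>: solutions of the thermostatic
  system can be restarted at any time (\<open>solution_shift\<close>) and prolonged backwards by a trajectory with
  constant control (\<open>solution_glue\<close>). From below (\<open>Veps_lower\<close>), every coherent state
  has, for each time \<open>\<tau>\<close>, a successor \<open>(y, j)\<close> with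
  \<open>V\<^sub>\<epsilon>(x\<^sub>0, i\<^sub>0) \<ge> \<tau> m - p (y - x\<^sub>0) + exp (-\<lambda> \<tau>) V\<^sub>\<epsilon>(y, j)\<close> up to errors of higher order, where \<open>m\<close> bounds
  \<open>G\<^sub>j + p F\<^sub>j\<close> from below over all controls and all outputs that can occur. From above
  (\<open>Veps_constant_control\<close>), a constant control \<open>a\<close> on branch \<open>j\<close> gives the reverse inequality with
  \<open>G\<^sub>j + p F\<^sub>j\<close> evaluated at \<open>a\<close>. By controllability, a state within \<open>\<epsilon>\<close> of the junction is joined to
  \<open>(i \<epsilon>, i)\<close> and back in a time of order \<open>\<epsilon>\<close>; hence \<open>V\<^sub>\<epsilon>\<close> is uniformly close to \<open>V\<close> on all
  coherent states, also on those behind the junction (\<open>Veps_uniform\<close>).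

  Passing to the limit \<open>\<epsilon> \<rightarrow> 0\<close> with \<open>\<tau>\<close> fixed, and then to \<open>\<tau> \<rightarrow> 0\<close>, the lower inequality yields all
  supersolution properties: away from \<open>0\<close> the output does not switch, and at \<open>0\<close> both outputs can occur,
  which is why the maximum of the two Hamiltonians appears. The upper inequality yields the subsolution
  properties away from \<open>0\<close> and, at \<open>0\<close>, the inequality
  \<open>\<lambda> V(0) \<le> G\<^sub>j(0,a) + p F\<^sub>j(0,a)\<close> for every control \<open>a\<close> that does not leave branch \<open>j\<close>, that is, with
  \<open>j F\<^sub>j(0,a) \<ge> 0\<close>.

  If the junction subsolution condition failed, both branches would therefore have a violating control,
  \<open>a\<^sub>1\<close> and \<open>a\<^sub>2\<close>, with \<open>F\<^sub>1(0,a\<^sub>1) < 0 < F\<^sub>-\<^sub>1(0,a\<^sub>2)\<close>. These two drive a closed loop of the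
  thermostat: down on branch \<open>1\<close> with \<open>a\<^sub>1\<close>, up on branch \<open>-1\<close> with \<open>a\<^sub>2\<close>. A short excursion of length
  \<open>\<epsilon>\<^sup>2\<close> beyond each threshold makes the output really switch. Adding the upper inequality along the four
  sides of the loop, the values of \<open>V\<^sub>\<epsilon>\<close> and the terms \<open>p (y - x)\<close> cancel, and the time of order \<open>\<epsilon>\<close>
  spent with \<open>a\<^sub>1\<close>, \<open>a\<^sub>2\<close> contradicts the strict violation (\<open>subsolution_loop_contradiction\<close>).
\<close>

section \<open>Scalar autonomous differential equations\<close>

lemma integral_has_derivative_halfline:
  fixes h :: "real \<Rightarrow> real"
  assumes "continuous_on {0..} h" "t \<ge> 0"
  shows "((\<lambda>r. integral {0..r} h) has_real_derivative h t) (at t within {0..})"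
proof -
  have "((\<lambda>r. integral {0..r} h) has_real_derivative h t) (at t within {0..t+1})"
    using assms by (intro integral_has_real_derivative continuous_on_subset[OF assms(1)]) auto
  moreover have "at t within {0..t+1} = at t within {0..}"
    using assms by (intro at_within_nhd[of _ "{..<t+1}"]) auto
  ultimately show ?thesis by simp
qed

text \<open>
  Global existence by Banach's fixed point theorem: with the weight \<open>exp (-2 L t)\<close> the Picard operator
  is a contraction with constant \<open>1/2\<close> on bounded continuous functions.
\<close>

lemma ode_exists:
  fixes g :: "real \<Rightarrow> real"
  assumes lip: "\<And>x y. \<bar>g x - g y\<bar> \<le> L * \<bar>x - y\<bar>" and L: "L > 0"
    and bd: "\<And>x. \<bar>g x\<bar> \<le> M"
  shows "\<exists>x. x 0 = x0 \<and> (\<forall>t\<ge>0. (x has_real_derivative g (x t)) (at t within {0..}))"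
proof -
  have M: "M \<ge> 0" using bd[of 0] by linarith
  have gcont: "continuous_on S g" for S
    by (rule lipschitz_on_continuous_on[of L])
       (use lip L in \<open>auto simp: lipschitz_on_def dist_real_def\<close>)
  define h where "h u s = g (x0 + exp (2 * L * s) * apply_bcontfun u s)" for u :: "real \<Rightarrow>\<^sub>C real" and s
  have hcont: "continuous_on S (h u)" for S u
    unfolding h_def by (intro continuous_on_compose2[OF gcont[of UNIV]] continuous_intros) auto
  have hint: "h u integrable_on {0..r}" for u r
    by (intro integrable_continuous_interval hcont)
  \<comment> \<open>the Picard operator in the unknown \<open>u t = exp (-2 L t) (x t - x0)\<close>, constant for \<open>t \<le> 0\<close>\<close>
  define P where "P u t = exp (- 2*L*max t 0) * integral {0..max t 0} (h u)" for u t
  have Pcont: "continuous_on UNIV (P u)" for u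
  proof -
    have "continuous_on {0..} (\<lambda>r. integral {0..r} (h u))"
      by (rule DERIV_continuous_on[where D="h u"])
         (use integral_has_derivative_halfline[OF hcont] in auto)
    then have "continuous_on UNIV (\<lambda>t. integral {0..max t 0} (h u))"
      by (rule continuous_on_compose2) (auto intro!: continuous_intros)
    then show ?thesis unfolding P_def by (intro continuous_intros)
  qed
  have Pbd: "norm (P u t) \<le> M / (2*L)" for u t
  proof -
    define r where "r = max t 0"
    have r: "r \<ge> 0" unfolding r_def by (rule max.cobounded2)
    have "norm (integral {0..r} (h u)) \<le> M * (r - 0)"
      using r bd by (intro integral_bound hcont) (auto simp: h_def)
    moreover have "2*L*r \<le> exp (2*L*r)" using exp_ge_add_one_self[of "2*L*r"] by linarith
    then have "r \<le> exp (2*L*r) / (2*L)" using L by (simp add: field_simps)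
    then have "M * r \<le> M * (exp (2*L*r) / (2*L))" using M by (rule mult_left_mono)
    ultimately have "norm (integral {0..r} (h u)) \<le> M * exp (2*L*r) / (2*L)" by simp
    then show ?thesis
      unfolding P_def r_def[symmetric] using L
      by (simp add: abs_mult exp_minus field_simps)
  qed
  define \<Phi> where "\<Phi> u = Bcontfun (P u)" for u
  have \<Phi>: "apply_bcontfun (\<Phi> u) = P u" for u
    unfolding \<Phi>_def by (intro Bcontfun_inverse bcontfun_normI[OF Pcont Pbd])
  have contr: "dist (\<Phi> u) (\<Phi> v) \<le> 1/2 * dist u v" for u v
  proof (rule dist_bound)
    fix t :: real
    define r where "r = max t 0"
    have r: "r \<ge> 0" unfolding r_def by (rule max.cobounded2)
    have ei: "((\<lambda>s. L * exp (2 * L * s) * dist u v) has_integral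
        (exp (2*L*r) / 2 * dist u v - exp (2*L*0) / 2 * dist u v)) {0..r}"
      using r L by (intro fundamental_theorem_of_calculus)
        (auto intro!: derivative_eq_intros simp: has_real_derivative_iff_has_vector_derivative[symmetric])
    have "norm (integral {0..r} (\<lambda>s. h u s - h v s)) \<le> integral {0..r} (\<lambda>s. L * exp (2 * L * s) * dist u v)"
    proof (rule integral_norm_bound_integral)
      show "(\<lambda>s. h u s - h v s) integrable_on {0..r}" using hint by (intro integrable_diff)
      show "(\<lambda>s. L * exp (2 * L * s) * dist u v) integrable_on {0..r}" using ei by blast
      fix s
      have "norm (h u s - h v s) \<le> L * \<bar>exp (2 * L * s) * u s - exp (2 * L * s) * v s\<bar>"
        unfolding h_def using lip[of "x0 + exp (2 * L * s) * u s" "x0 + exp (2 * L * s) * v s"] by simp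
      also have "\<dots> = L * exp (2 * L * s) * dist (u s) (v s)"
        by (simp add: dist_real_def abs_mult right_diff_distrib[symmetric])
      also have "\<dots> \<le> L * exp (2 * L * s) * dist u v"
        using L by (intro mult_left_mono dist_bounded) auto
      finally show "norm (h u s - h v s) \<le> L * exp (2 * L * s) * dist u v" .
    qed
    also have "\<dots> = (exp (2*L*r) / 2 - 1/2) * dist u v"
      using integral_unique[OF ei] by (simp add: algebra_simps)
    also have "\<dots> \<le> exp (2*L*r) / 2 * dist u v" by (intro mult_right_mono) auto
    finally have *: "norm (integral {0..r} (\<lambda>s. h u s - h v s)) \<le> exp (2*L*r) / 2 * dist u v" .
    have "dist (P u t) (P v t) = exp (-2*L*r) * norm (integral {0..r} (\<lambda>s. h u s - h v s))"
      unfolding P_def r_def[symmetric] dist_real_def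
      by (subst integral_diff[OF hint hint]) (simp add: abs_mult right_diff_distrib[symmetric])
    also have "\<dots> \<le> exp (-2*L*r) * (exp (2*L*r) / 2 * dist u v)"
      by (intro mult_left_mono *) auto
    also have "\<dots> = 1/2 * dist u v" by (simp add: exp_minus field_simps)
    finally show "dist ((\<Phi> u) t) ((\<Phi> v) t) \<le> 1/2 * dist u v" by (simp add: \<Phi>)
  qed
  obtain u where u: "\<Phi> u = u"
    using banach_fix_type[of "1/2" \<Phi>] contr by auto
  define x where "x t = x0 + exp (2*L*t) * u t" for t
  have x: "x t = x0 + integral {0..t} (h u)" if "t \<ge> 0" for t
  proof -
    have "u t = exp (-2*L*t) * integral {0..t} (h u)"
    proof -
      have "apply_bcontfun u t = P u t" using \<Phi>[of u] u by metis
      then show ?thesis unfolding P_def using that by (simp add: max_absorb1)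
    qed
    then show ?thesis unfolding x_def by (simp add: exp_minus)
  qed
  have hx: "h u = (\<lambda>s. g (x s))" unfolding h_def x_def by (rule refl)
  have "(x has_real_derivative g (x t)) (at t within {0..})" if "t \<ge> 0" for t
  proof -
    have "((\<lambda>t. x0 + integral {0..t} (h u)) has_real_derivative h u t) (at t within {0..})"
      using integral_has_derivative_halfline[OF hcont that] by (auto intro!: derivative_eq_intros)
    then show ?thesis unfolding hx[symmetric]
      using x that by (subst has_field_derivative_cong_eventually[where g="\<lambda>t. x0 + integral {0..t} (h u)"])
        (auto simp: eventually_at_filter hx)
  qed
  moreover have "x 0 = x0" using x[of 0] by simp
  ultimately show ?thesis by blast
qed

text \<open>
  A trajectory does not cross downwards a level at which the field does not point downwards.
\<close>

lemma ode_barrier: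
  fixes g :: "real \<Rightarrow> real"
  assumes lip: "\<And>x y. \<bar>g x - g y\<bar> \<le> L * \<bar>x - y\<bar>"
    and x: "\<And>t. t \<ge> 0 \<Longrightarrow> (x has_real_derivative g (x t)) (at t within {0..})"
    and m: "g m \<ge> 0" "x 0 \<ge> m" and t: "t \<ge> 0"
  shows "x t \<ge> m"
proof (rule ccontr)
  assume "\<not> x t \<ge> m"
  have xc: "continuous_on {0..} x"
    by (rule DERIV_continuous_on[where D="\<lambda>t. g (x t)"]) (use x in auto)
  define S where "S = {r\<in>{0..t}. x r \<ge> m}"
  have "closed S"
    unfolding S_def using continuous_on_subset[OF xc, of "{0..t}"]
    by (intro continuous_on_closed_Collect_le) auto
  moreover have ne: "0 \<in> S" using m t by (simp add: S_def)
  moreover have bd: "bdd_above S" unfolding S_def by (auto intro: bdd_aboveI[of _ t])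
  ultimately have "Sup S \<in> S" by (intro closed_contains_Sup) auto
  then obtain s where s: "s \<in> S" "s = Sup S" by blast
  have st: "0 \<le> s" "s < t" "x s \<ge> m" 
    using s(1) \<open>\<not> x t \<ge> m\<close> unfolding S_def by (auto simp: less_le)
  have below: "x r < m" if "s < r" "r \<le> t" for r
  proof (rule ccontr)
    assume "\<not> x r < m"
    then have "r \<in> S" using that st by (auto simp: S_def)
    then have "r \<le> s" unfolding s(2) using bd by (rule cSup_upper)
    with that show False by simp
  qed
  \<comment> \<open>after the last time \<open>s\<close> above \<open>m\<close>, Gronwall's argument for \<open>m - x\<close>\<close>
  define h where "h r = (m - x r) * exp (-L*r)" for r
  have "h t \<le> h s"
  proof (rule DERIV_nonpos_imp_decreasing_open[where f=h])
    show "s \<le> t" using st by simp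
    show "continuous_on {s..t} h"
      unfolding h_def using st by (intro continuous_intros continuous_on_subset[OF xc]) auto
    fix r assume r: "s < r" "r < t"
    have "(x has_real_derivative g (x r)) (at r)"
      using x[of r] r st at_within_interior[of r "{0..}"] by simp
    then have "(h has_real_derivative (- g (x r) - L * (m - x r)) * exp (-L*r)) (at r)"
      unfolding h_def by (auto intro!: derivative_eq_intros simp: algebra_simps)
    moreover have "- g (x r) - L * (m - x r) \<le> 0"
      using lip[of m "x r"] below[of r] r m by simp
    ultimately show "\<exists>y. (h has_real_derivative y) (at r) \<and> y \<le> 0"
      by (meson mult_nonpos_nonneg exp_ge_zero)
  qed
  moreover have "h s \<le> 0" unfolding h_def using st by (intro mult_nonpos_nonneg) auto
  moreover have "h t > 0" unfolding h_def using \<open>\<not> x t \<ge> m\<close> by simp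
  ultimately show False by simp
qed

lemma increment_eq_derivative_times:
  fixes x :: "real \<Rightarrow> real"
  assumes x: "\<And>t. t \<ge> 0 \<Longrightarrow> (x has_real_derivative d t) (at t within {0..})"
    and T: "0 \<le> T"
  shows "\<exists>\<xi>\<in>{0..T}. x T - x 0 = d \<xi> * T"
proof (cases "T = 0")
  case True then show ?thesis by auto
next
  case False
  have xc: "continuous_on {0..} x"
    by (rule DERIV_continuous_on[where D=d]) (use x in auto)
  obtain \<xi> where "0 < \<xi>" "\<xi> < T" "x T - x 0 = (\<lambda>h. d \<xi> * h) (T - 0)"
  proof (rule mvt[where f=x and f'="\<lambda>\<xi> h. d \<xi> * h" and a=0 and b=T])
    show "0 < T" using T False by simp
    show "continuous_on {0..T} x" by (rule continuous_on_subset[OF xc]) auto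
    fix \<xi> assume "0 < \<xi>" "\<xi> < T"
    then show "(x has_derivative (\<lambda>h. d \<xi> * h)) (at \<xi>)"
      using x[of \<xi>] at_within_interior[of \<xi> "{0..}"] by (simp add: has_field_derivative_def)
  qed
  then show ?thesis by (intro bexI[of _ \<xi>]) auto
qed

text \<open>
  As long as the field is at least \<open>c\<close> between \<open>y0\<close> and \<open>y1\<close>, the trajectory from \<open>y0\<close> reaches \<open>y1\<close> in
  a time between \<open>(y1 - y0) / M\<close> and \<open>(y1 - y0) / c\<close>.
\<close>

lemma ode_travel_up:
  fixes g :: "real \<Rightarrow> real"
  assumes lip: "\<And>x y. \<bar>g x - g y\<bar> \<le> L * \<bar>x - y\<bar>" and L: "L > 0"
    and bd: "\<And>x. \<bar>g x\<bar> \<le> M" and c: "c > 0" and y: "y0 \<le> y1"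
    and pos: "\<And>z. y0 \<le> z \<Longrightarrow> z \<le> y1 \<Longrightarrow> g z \<ge> c"
  shows "\<exists>x T. 0 \<le> T \<and> c * T \<le> y1 - y0 \<and> y1 - y0 \<le> M * T \<and> x 0 = y0 \<and> x T = y1
     \<and> (\<forall>t\<in>{0..T}. y0 + c * t \<le> x t \<and> x t \<le> y1)
     \<and> (\<forall>t\<ge>0. (x has_real_derivative g (x t)) (at t within {0..}))"
proof -
  obtain x where x0: "x 0 = y0" and
    x: "\<And>t. t \<ge> 0 \<Longrightarrow> (x has_real_derivative g (x t)) (at t within {0..})"
    using ode_exists[OF lip L bd] by blast
  have xc: "continuous_on S x" if "S \<subseteq> {0..}" for S
    by (rule continuous_on_subset[OF DERIV_continuous_on[where D="\<lambda>t. g (x t)" and s="{0..}"] that])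
       (use x in auto)
  have ge: "x t \<ge> y0" if "t \<ge> 0" for t
    using ode_barrier[OF lip x _ _ that, of y0] pos[of y0] c y x0 by simp
  have grow: "y0 + c * t \<le> x t" if t: "t \<ge> 0" and le: "\<And>r. 0 \<le> r \<Longrightarrow> r \<le> t \<Longrightarrow> x r \<le> y1" for t
  proof -
    obtain \<xi> where \<xi>: "\<xi> \<in> {0..t}" "x t - x 0 = g (x \<xi>) * t"
      using increment_eq_derivative_times[OF x t] by blast
    have "c \<le> g (x \<xi>)" using \<xi> ge le by (intro pos) auto
    then have "c * t \<le> g (x \<xi>) * t" using t by (rule mult_right_mono)
    with \<xi> x0 show ?thesis by simp
  qed
  define S where "S = {t\<in>{0..}. x t = y1}"
  have "S \<noteq> {}"
  proof
    assume e: "S = {}"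
    have lt: "x t < y1" if "t \<ge> 0" for t
    proof (rule ccontr)
      assume "\<not> x t < y1"
      then have "\<exists>r\<ge>0. r \<le> t \<and> x r = y1" using x0 y that by (intro IVT' xc) auto
      with e show False by (auto simp: S_def)
    qed
    have "y0 + c * ((y1 - y0) / c) \<le> x ((y1 - y0) / c)"
      using y c lt by (intro grow) (auto simp: less_imp_le)
    with lt[of "(y1 - y0) / c"] y c show False by simp
  qed
  moreover have "closed S" unfolding S_def
    by (intro continuous_closed_preimage_constant xc) auto
  moreover have bS: "bdd_below S" unfolding S_def by (auto intro: bdd_belowI[of _ 0])
  ultimately have "Inf S \<in> S" by (intro closed_contains_Inf) auto
  then obtain T where T: "T \<in> S" "T = Inf S" by blast
  have T0: "T \<ge> 0" "x T = y1" using T by (auto simp: S_def)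
  have le: "x t \<le> y1" if "0 \<le> t" "t \<le> T" for t
  proof (rule ccontr)
    assume n: "\<not> x t \<le> y1"
    then have "\<exists>r\<ge>0. r \<le> t \<and> x r = y1" using x0 y that by (intro IVT' xc) auto
    then obtain r where r: "r \<ge> 0" "r \<le> t" "x r = y1" by blast
    then have "r \<noteq> t" using n by auto
    moreover have "T \<le> r" unfolding T(2) using r bS by (intro cInf_lower) (auto simp: S_def)
    ultimately show False using r that by simp
  qed
  have "y0 + c * t \<le> x t" if "0 \<le> t" "t \<le> T" for t
    using that le by (intro grow) auto
  moreover have "y1 - y0 \<le> M * T"
  proof -
    obtain \<xi> where \<xi>: "x T - x 0 = g (x \<xi>) * T"
      using increment_eq_derivative_times[OF x T0(1)] by blast
    have "g (x \<xi>) * T \<le> M * T" using bd[of "x \<xi>"] T0 by (intro mult_right_mono) auto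
    with \<xi> T0 x0 show ?thesis by simp
  qed
  moreover from calculation(1)[of T] have "c * T \<le> y1 - y0" using T0 by simp
  ultimately show ?thesis using T0 x0 x le
    by (intro exI[of _ x] exI[of _ T] conjI ballI allI impI) (simp_all add: field_simps)
qed

text \<open>
  The same in the direction given by the sign \<open>s\<close>.
\<close>

lemma ode_travel:
  fixes g :: "real \<Rightarrow> real"
  assumes lip: "\<And>x y. \<bar>g x - g y\<bar> \<le> L * \<bar>x - y\<bar>" and L: "L > 0"
    and bd: "\<And>x. \<bar>g x\<bar> \<le> M" and c: "c > 0" and s: "s = 1 \<or> s = -1" and y: "s * (y1 - y0) \<ge> 0"
    and pos: "\<And>z. 0 \<le> s * (z - y0) \<Longrightarrow> s * (z - y0) \<le> s * (y1 - y0) \<Longrightarrow> s * g z \<ge> c"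
  shows "\<exists>x T. 0 \<le> T \<and> c * T \<le> s * (y1 - y0) \<and> s * (y1 - y0) \<le> M * T \<and> x 0 = y0 \<and> x T = y1
     \<and> (\<forall>t\<in>{0..T}. c * t \<le> s * (x t - y0) \<and> s * (x t - y0) \<le> s * (y1 - y0))
     \<and> (\<forall>t\<ge>0. (x has_real_derivative g (x t)) (at t within {0..}))"
  using s
proof
  assume s: "s = 1"
  show ?thesis
  proof -
    have "y0 \<le> y1" using y s by simp
    moreover have "g z \<ge> c" if "y0 \<le> z" "z \<le> y1" for z using pos[of z] that s by simp
    ultimately obtain x T where x: "0 \<le> T" "c * T \<le> y1 - y0" "y1 - y0 \<le> M * T" "x 0 = y0" "x T = y1"
     "\<forall>t\<in>{0..T}. y0 + c * t \<le> x t \<and> x t \<le> y1"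
     "\<forall>t\<ge>0. (x has_real_derivative g (x t)) (at t within {0..})"
      using ode_travel_up[OF lip L bd c, of y0 y1] by blast
    then show ?thesis unfolding s by (intro exI[of _ x] exI[of _ T]) auto
  qed
next
  assume s: "s = -1"
  have lip': "\<bar>- g (- x) - - g (- y)\<bar> \<le> L * \<bar>x - y\<bar>" for x y using lip[of "-y" "-x"] by simp
  have bd': "\<bar>- g (- x)\<bar> \<le> M" for x using bd by simp
  have "\<exists>x T. 0 \<le> T \<and> c * T \<le> - y1 - - y0 \<and> - y1 - - y0 \<le> M * T \<and> x 0 = - y0 \<and> x T = - y1
     \<and> (\<forall>t\<in>{0..T}. - y0 + c * t \<le> x t \<and> x t \<le> - y1)
     \<and> (\<forall>t\<ge>0. (x has_real_derivative - g (- x t)) (at t within {0..}))"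
  proof (rule ode_travel_up[OF lip' L bd' c])
    show "- y0 \<le> - y1" using y s by simp
    show "c \<le> - g (- z)" if "- y0 \<le> z" "z \<le> - y1" for z using pos[of "- z"] that s by simp
  qed
  then obtain x T where x: "0 \<le> T" "c * T \<le> - y1 - - y0" "- y1 - - y0 \<le> M * T" "x 0 = - y0" "x T = - y1"
     "\<forall>t\<in>{0..T}. - y0 + c * t \<le> x t \<and> x t \<le> - y1"
     "\<forall>t\<ge>0. (x has_real_derivative - g (- x t)) (at t within {0..})" by blast
  have "((\<lambda>t. - x t) has_real_derivative g (- x t)) (at t within {0..})" if "t \<ge> 0" for t
    using x(7) that by (auto intro!: derivative_eq_intros)
  then show ?thesis using x s
    by (intro exI[of _ "\<lambda>t. - x t"] exI[of _ T]) auto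
qed

lemma ode_has_integral:
  fixes x :: "real \<Rightarrow> real"
  assumes x: "\<And>t. t \<ge> 0 \<Longrightarrow> (x has_real_derivative g (x t)) (at t within {0..})" and st: "0 \<le> s" "s \<le> t"
  shows "((\<lambda>r. g (x r)) has_integral x t - x s) {s..t}"
proof (rule fundamental_theorem_of_calculus[OF st(2)])
  fix r assume "r \<in> {s..t}"
  then have "(x has_real_derivative g (x r)) (at r within {s..t})"
    using st by (intro DERIV_subset[OF x]) auto
  then show "(x has_vector_derivative g (x r)) (at r within {s..t})"
    by (simp add: has_real_derivative_iff_has_vector_derivative)
qed

lemma ode_continuous:
  fixes x :: "real \<Rightarrow> real"
  assumes "\<And>t. t \<ge> 0 \<Longrightarrow> (x has_real_derivative g (x t)) (at t within {0..})"
  shows "continuous_on {0..} x"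
  by (rule DERIV_continuous_on[where D="\<lambda>t. g (x t)"]) (use assms in auto)

lemma ode_barrier_sign:
  fixes g :: "real \<Rightarrow> real"
  assumes lip: "\<And>x y. \<bar>g x - g y\<bar> \<le> L * \<bar>x - y\<bar>"
    and x: "\<And>t. t \<ge> 0 \<Longrightarrow> (x has_real_derivative g (x t)) (at t within {0..})"
    and s: "s = 1 \<or> s = -1" and m: "s * g m \<ge> 0" "s * x 0 \<ge> s * m" and t: "t \<ge> 0"
  shows "s * x t \<ge> s * m"
  using s
proof
  assume "s = 1"
  then show ?thesis using ode_barrier[OF lip x _ _ t, of m] m by simp
next
  assume s: "s = -1"
  have "- m \<le> - x t"
  proof (rule ode_barrier[where g="\<lambda>z. - g (- z)" and x="\<lambda>t. - x t" and L=L and m="-m"])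
    show "\<bar>- g (- x) - - g (- y)\<bar> \<le> L * \<bar>x - y\<bar>" for x y using lip[of "-y" "-x"] by simp
    show "((\<lambda>t. - x t) has_real_derivative - g (- (- x t))) (at t within {0..})" if "t \<ge> 0" for t
      using x[OF that] by (auto intro!: derivative_eq_intros)
  qed (use m s t in auto)
  then show ?thesis using s by simp
qed

section \<open>The thermostat\<close>

text \<open>
  The two branches exchange their roles under \<open>(x, i) \<mapsto> (-x, -i)\<close>. In terms of the product \<open>i u\<close>
  the thermostat rules take a form that does not mention the sign of the output.
\<close>

lemma thermostat_iff:
  "thermostat \<epsilon> u i0 i \<longleftrightarrow> i 0 = i0 \<and>
    (\<forall>t\<ge>0. (i t = 1 \<or> i t = -1) \<and> real_of_int (i t) * u t \<ge> -\<epsilon>) \<and>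
    (\<forall>s\<ge>0. \<forall>t>s. i s = - i t \<longrightarrow> (\<exists>r\<in>{s<..t}. real_of_int (i t) * u r > \<epsilon>))"
  (is "?L \<longleftrightarrow> ?R")
proof
  assume L: ?L
  have v: "i t = 1 \<or> i t = -1" if "t \<ge> 0" for t using L that unfolding thermostat_def by auto
  have "real_of_int (i t) * u t \<ge> -\<epsilon>" if "t \<ge> 0" for t
    using v[OF that] L that unfolding thermostat_def by fastforce
  moreover have "\<exists>r\<in>{s<..t}. real_of_int (i t) * u r > \<epsilon>" if a: "s \<ge> 0" "t > s" "i s = - i t" for s t
  proof (cases "i t = 1")
    case True
    then show ?thesis using L that unfolding thermostat_def by simp
  next
    case False
    then have "i t = -1" using v[of t] that by auto
    moreover from this obtain r where "r\<in>{s<..t}" "u r < -\<epsilon>"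
      using L a unfolding thermostat_def by (metis minus_minus)
    ultimately show ?thesis by (intro bexI[of _ r]) auto
  qed
  ultimately show ?R using L v unfolding thermostat_def by blast
next
  assume R: ?R
  have a: "i t = 1 \<or> i t = -1" "real_of_int (i t) * u t \<ge> -\<epsilon>" if "t \<ge> 0" for t using R that by auto
  have "i t = -1" if "t \<ge> 0" "u t < -\<epsilon>" for t using a[OF that(1)] that by auto
  moreover have "i t = 1" if "t \<ge> 0" "u t > \<epsilon>" for t using a[OF that(1)] that by auto
  moreover have "\<exists>r\<in>{s<..t}. u r < -\<epsilon>" if "s \<ge> 0" "t > s" "i s = 1" "i t = -1" for s t
  proof -
    have "\<exists>r\<in>{s<..t}. real_of_int (i t) * u r > \<epsilon>" using R that by auto
    then obtain r where "r\<in>{s<..t}" "real_of_int (i t) * u r > \<epsilon>" by blast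
    then show ?thesis using that by (intro bexI[of _ r]) auto
  qed
  moreover have "\<exists>r\<in>{s<..t}. u r > \<epsilon>" if "s \<ge> 0" "t > s" "i s = -1" "i t = 1" for s t
  proof -
    have "\<exists>r\<in>{s<..t}. real_of_int (i t) * u r > \<epsilon>" using R that by auto
    then show ?thesis using that by auto
  qed
  ultimately show ?L using R a unfolding thermostat_def by blast
qed

lemma thermostat_shift:
  assumes "thermostat \<epsilon> u i0 i" "\<tau> \<ge> 0"
  shows "thermostat \<epsilon> (\<lambda>t. u (\<tau> + t)) (i \<tau>) (\<lambda>t. i (\<tau> + t))"
  unfolding thermostat_iff
proof (intro conjI allI impI)
  fix s t :: real assume st: "0 \<le> s" "s < t" "i (\<tau> + s) = - i (\<tau> + t)"
  then have "\<exists>r\<in>{\<tau> + s<..\<tau> + t}. real_of_int (i (\<tau> + t)) * u r > \<epsilon>"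
    using assms unfolding thermostat_iff by simp
  then obtain r where "r \<in> {\<tau> + s<..\<tau> + t}" "real_of_int (i (\<tau> + t)) * u r > \<epsilon>" by blast
  then show "\<exists>r\<in>{s<..t}. \<epsilon> < real_of_int (i (\<tau> + t)) * u (\<tau> + r)"
    by (intro bexI[of _ "r - \<tau>"]) auto
qed (use assms in \<open>auto simp: thermostat_iff\<close>)

text \<open>
  Since the output at a switching instant is the old one, thermostat outputs can be concatenated at any
  time \<open>T\<close> at which the first piece ends with the initial output of the second.
\<close>

lemma thermostat_glue:
  assumes T: "T \<ge> 0" and tail: "thermostat \<epsilon> v (i T) k"
    and i0: "i 0 = i0"
    and head: "\<And>t. 0 \<le> t \<Longrightarrow> t \<le> T \<Longrightarrow> (i t = 1 \<or> i t = -1) \<and> real_of_int (i t) * u t \<ge> -\<epsilon>"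
    and switch: "\<And>s t. 0 \<le> s \<Longrightarrow> s < t \<Longrightarrow> t \<le> T \<Longrightarrow> i s = - i t
        \<Longrightarrow> \<exists>r\<in>{s<..t}. real_of_int (i t) * u r > \<epsilon>"
  shows "thermostat \<epsilon> (\<lambda>t. if t \<le> T then u t else v (t - T)) i0
            (\<lambda>t. if t \<le> T then i t else k (t - T))"
  unfolding thermostat_iff
proof (intro conjI allI impI)
  let ?i = "\<lambda>t. if t \<le> T then i t else k (t - T)"
  let ?u = "\<lambda>t. if t \<le> T then u t else v (t - T)"
  show "?i 0 = i0" using T i0 by simp
  have k: "k 0 = i T" "\<And>t. t \<ge> 0 \<Longrightarrow> (k t = 1 \<or> k t = -1) \<and> real_of_int (k t) * v t \<ge> -\<epsilon>"
    "\<And>s t. 0 \<le> s \<Longrightarrow> s < t \<Longrightarrow> k s = - k t \<Longrightarrow> \<exists>r\<in>{s<..t}. real_of_int (k t) * v r > \<epsilon>"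
    using tail unfolding thermostat_iff by auto
  fix t :: real assume "t \<ge> 0"
  then show "?i t = 1 \<or> ?i t = -1" "- \<epsilon> \<le> real_of_int (?i t) * ?u t"
    using head[of t] k(2)[of "t - T"] by auto
next
  let ?i = "\<lambda>t. if t \<le> T then i t else k (t - T)"
  let ?u = "\<lambda>t. if t \<le> T then u t else v (t - T)"
  have k: "k 0 = i T" "\<And>t. t \<ge> 0 \<Longrightarrow> (k t = 1 \<or> k t = -1)"
    "\<And>s t. 0 \<le> s \<Longrightarrow> s < t \<Longrightarrow> k s = - k t \<Longrightarrow> \<exists>r\<in>{s<..t}. real_of_int (k t) * v r > \<epsilon>"
    using tail unfolding thermostat_iff by auto
  fix s t :: real assume st: "0 \<le> s" "s < t" "?i s = - ?i t"
  have *: "\<exists>r\<in>{s<..t}. real_of_int (?i t) * ?u r > \<epsilon>"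
    if a: "0 \<le> s'" "s \<le> T + s'" "T < t" "k s' = - k (t - T)" "s' < t - T" for s'
  proof -
    obtain r where "r \<in> {s'<..t - T}" "real_of_int (k (t - T)) * v r > \<epsilon>"
      using k(3)[OF a(1,5,4)] by blast
    then show ?thesis using a by (intro bexI[of _ "T + r"]) auto
  qed
  consider "t \<le> T" | "T < t" "s \<le> T" "i T = i s" | "T < t" "s \<le> T" "i T \<noteq> i s" | "T < s" by linarith
  then show "\<exists>r\<in>{s<..t}. real_of_int (?i t) * ?u r > \<epsilon>"
  proof cases
    case 1
    then obtain r where "r \<in> {s<..t}" "real_of_int (i t) * u r > \<epsilon>" using switch[of s t] st by auto
    with 1 show ?thesis by (intro bexI[of _ r]) auto
  next
    case 2
    then show ?thesis using st k(1) by (intro *[of 0]) auto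
  next
    case 3
    then have "i s = - i T" "k (t - T) = i T" "s < T"
      using head[of s] head[of T] k(2)[of "t - T"] st T by (auto simp: less_le)
    then obtain r where "r \<in> {s<..T}" "real_of_int (i T) * u r > \<epsilon>" using switch[of s T] st by auto
    with 3 \<open>k (t - T) = i T\<close> show ?thesis by (intro bexI[of _ r]) auto
  next
    case 4
    then show ?thesis using st by (intro *[of "s - T"]) auto
  qed
qed

text \<open>
  On a time interval of length \<open>\<epsilon> / M\<close> the \<open>M\<close>-Lipschitz input oscillates by at most \<open>\<epsilon>\<close>, so that it cannot be both
  below \<open>-\<epsilon>\<close> and above \<open>\<epsilon>\<close>; the times with output \<open>1\<close> therefore form a subinterval.
\<close>

lemma thermostat_measurable:
  assumes th: "thermostat \<epsilon> u i0 i" and \<epsilon>: "\<epsilon> > 0" and M: "M > 0"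
    and lip: "\<And>s t. s \<ge> 0 \<Longrightarrow> t \<ge> 0 \<Longrightarrow> \<bar>u s - u t\<bar> \<le> M * \<bar>s - t\<bar>"
  shows "i \<in> lebesgue_on {0..} \<rightarrow>\<^sub>M count_space UNIV"
proof -
  define \<delta> where "\<delta> = \<epsilon> / M"
  have \<delta>: "\<delta> > 0" unfolding \<delta>_def using \<epsilon> M by simp
  define I where "I k = {real k * \<delta>..real k * \<delta> + \<delta>}" for k
  define S where "S = {t\<in>{0..}. i t = 1}"
  have v: "i t = 1 \<or> i t = -1" if "t \<ge> 0" for t using th that unfolding thermostat_iff by blast
  have I0: "t \<ge> 0" if "t \<in> I k" for t k
  proof -
    have "real k * \<delta> \<ge> 0" using \<delta> by simp
    then show ?thesis using that unfolding I_def atLeastAtMost_iff by linarith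
  qed
  have osc: "\<bar>u s - u t\<bar> \<le> \<epsilon>" if "s \<in> I k" "t \<in> I k" for s t k
  proof -
    have "\<bar>u s - u t\<bar> \<le> M * \<bar>s - t\<bar>" using lip I0 that by blast
    also have "\<dots> \<le> M * \<delta>" using that M by (intro mult_left_mono) (auto simp: I_def)
    finally show ?thesis unfolding \<delta>_def using M by simp
  qed
  have "S \<inter> I k \<in> sets lebesgue" for k
  proof -
    have "is_interval (S \<inter> I k)"
      unfolding is_interval_1
    proof (intro ballI allI impI)
      fix a b t assume ab: "a \<in> S \<inter> I k" "b \<in> S \<inter> I k" and t: "a \<le> t \<and> t \<le> b"
      then have tI: "t \<in> I k" by (auto simp: I_def)
      then have t0: "t \<ge> 0" by (rule I0)
      have sub: "r \<in> I k" if "a \<le> r" "r \<le> b" for r using that ab by (auto simp: I_def)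
      have i: "i a = 1" "i b = 1" "a \<ge> 0" using ab by (auto simp: S_def)
      have "i t = 1"
      proof (rule ccontr)
        assume "i t \<noteq> 1"
        then have it: "i t = -1" using v t0 by blast
        then have "a < t" "t < b" using i t by (auto simp: less_le)
        \<comment> \<open>an output \<open>1, -1, 1\<close> at \<open>a < t < b\<close> needs one input value below \<open>-\<epsilon>\<close> and one above \<open>\<epsilon>\<close>\<close>
        then obtain r where r: "r \<in> {a<..t}" "real_of_int (i t) * u r > \<epsilon>"
          using th i it unfolding thermostat_iff by (metis minus_minus)
        obtain r' where r': "r' \<in> {t<..b}" "real_of_int (i b) * u r' > \<epsilon>"
          using th i it t0 \<open>t < b\<close> unfolding thermostat_iff by metis
        have "\<bar>u r - u r'\<bar> \<le> \<epsilon>" using sub r r' t by (intro osc[of _ k]) auto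
        with r r' i it \<epsilon> show False by auto
      qed
      with tI t0 show "t \<in> S \<inter> I k" by (simp add: S_def)
    qed
    then have "convex (S \<inter> I k)" by (simp add: is_interval_convex_1)
    moreover have "bounded (S \<inter> I k)" by (rule bounded_subset[of "I k"]) (auto simp: I_def)
    ultimately show ?thesis using measurable_convex by blast
  qed
  moreover have "S = (\<Union>k. S \<inter> I k)"
  proof -
    have "\<exists>k. t \<in> I k" if "t \<in> S" for t
    proof -
      have t: "t / \<delta> \<ge> 0" using that \<delta> by (simp add: S_def)
      define k where "k = nat \<lfloor>t / \<delta>\<rfloor>"
      have "real k \<le> t / \<delta>" "t / \<delta> \<le> real k + 1" unfolding k_def using t by linarith+
      then have "t \<in> I k" unfolding I_def using \<delta> by (simp add: field_simps)
      then show ?thesis by blast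
    qed
    then show ?thesis by blast
  qed
  moreover have "(\<Union>k. S \<inter> I k) \<in> sets lebesgue" using calculation(1) by blast
  ultimately have "S \<in> sets lebesgue" by simp
  then have "(\<lambda>t. if t \<in> S then 1 else -1) \<in> lebesgue_on {0..} \<rightarrow>\<^sub>M count_space (UNIV :: int set)"
    by (intro measurable_If_set) (auto simp: sets_restrict_space)
  moreover have "(if t \<in> S then 1 else -1) = i t" if "t \<in> space (lebesgue_on {0..})" for t
    using v[of t] that by (simp add: S_def) metis
  ultimately show ?thesis by (rule measurable_cong[THEN iffD1, rotated])
qed

section \<open>Measurability and discounted integrals\<close>

lemma measurable_translate:
  assumes "h \<in> lebesgue_on {0..} \<rightarrow>\<^sub>M N" "\<tau> \<ge> (0::real)"
  shows "(\<lambda>t. h (\<tau> + t)) \<in> lebesgue_on {0..} \<rightarrow>\<^sub>M N"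
proof -
  have "(+) \<tau> \<in> lebesgue \<rightarrow>\<^sub>M lebesgue" using lebesgue_affine_measurable[of "\<lambda>_. 1" \<tau>] by simp
  then have "(+) \<tau> \<in> lebesgue_on {0..} \<rightarrow>\<^sub>M lebesgue_on {0..}"
    using assms(2) by (intro measurable_restrict_space2 measurable_restrict_space1) auto
  from measurable_compose[OF this assms(1)] show ?thesis by simp
qed

lemma measurable_glue:
  assumes p: "p \<in> lebesgue_on {0..} \<rightarrow>\<^sub>M N" and q: "q \<in> lebesgue_on {0..} \<rightarrow>\<^sub>M N" and T: "T \<ge> (0::real)"
  shows "(\<lambda>t. if t < T then p t else q (t - T)) \<in> lebesgue_on {0..} \<rightarrow>\<^sub>M N"
proof (subst measurable_If_restrict_space_iff)
  show "{x \<in> space (lebesgue_on {0..}). x < T} \<in> sets (lebesgue_on {0..})"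
    by (auto simp: sets_restrict_space intro!: image_eqI[of _ _ "{0..<T}"])
  have "(\<lambda>t. t - T) \<in> lebesgue \<rightarrow>\<^sub>M lebesgue" using lebesgue_affine_measurable[of "\<lambda>_. 1" "- T"] by simp
  then have "(\<lambda>t. t - T) \<in> restrict_space (lebesgue_on {0..}) {x. \<not> x < T} \<rightarrow>\<^sub>M lebesgue_on {0..}"
    by (intro measurable_restrict_space2 measurable_restrict_space1) (auto simp: space_restrict_space)
  from measurable_compose[OF this q] p
  show "p \<in> restrict_space (lebesgue_on {0..}) {x. x < T} \<rightarrow>\<^sub>M N \<and>
    (\<lambda>x. q (x - T)) \<in> restrict_space (lebesgue_on {0..}) {x. \<not> x < T} \<rightarrow>\<^sub>M N"
    by (auto intro: measurable_restrict_space1)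
qed

text \<open>
  The space of controls need not be second countable, so the map \<open>t \<mapsto> (x t, \<alpha> t)\<close> into the product is
  avoided: \<open>x\<close> is approximated by functions with countably many values.
\<close>

lemma caratheodory_measurable:
  fixes g :: "real \<Rightarrow> 'a::metric_space \<Rightarrow> real"
  assumes x: "x \<in> borel_measurable N" and \<alpha>: "\<alpha> \<in> borel_measurable N"
    and A: "\<And>t. t \<in> space N \<Longrightarrow> \<alpha> t \<in> A"
    and ca: "\<And>y. continuous_on A (g y)"
    and cx: "\<And>a. a \<in> A \<Longrightarrow> continuous_on UNIV (\<lambda>y. g y a)"
  shows "(\<lambda>t. g (x t) (\<alpha> t)) \<in> borel_measurable N"
proof -
  have \<alpha>A: "\<alpha> \<in> N \<rightarrow>\<^sub>M restrict_space borel A"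
    using \<alpha> A by (intro measurable_restrict_space2) auto
  have fixed: "(\<lambda>t. g y (\<alpha> t)) \<in> borel_measurable N" for y
    using measurable_compose[OF \<alpha>A borel_measurable_continuous_on_restrict[OF ca]] .
  define q where "q n t = real_of_int \<lfloor>real (Suc n) * x t\<rfloor> / real (Suc n)" for n t
  have "(\<lambda>t. g (q n t) (\<alpha> t)) \<in> borel_measurable N" for n
  proof -
    have "(\<lambda>t. \<lfloor>real (Suc n) * x t\<rfloor>) \<in> N \<rightarrow>\<^sub>M count_space UNIV" using x by measurable
    with fixed show ?thesis unfolding q_def
      by (rule measurable_compose_countable[where f="\<lambda>k t. g (real_of_int k / real (Suc n)) (\<alpha> t)"
            and g="\<lambda>t. \<lfloor>real (Suc n) * x t\<rfloor>"])
  qed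
  moreover have "(\<lambda>n. g (q n t) (\<alpha> t)) \<longlonglongrightarrow> g (x t) (\<alpha> t)" if t: "t \<in> space N" for t
  proof -
    have "(\<lambda>n. q n t) \<longlonglongrightarrow> x t"
    proof (rule tendsto_sandwich)
      have "x t - 1 / real (Suc n) \<le> q n t" "q n t \<le> x t" for n
      proof -
        define m where "m = real (Suc n)"
        have "m > 0" unfolding m_def by simp
        have "(m * x t - 1) / m \<le> real_of_int \<lfloor>m * x t\<rfloor> / m"
          using \<open>m > 0\<close> by (intro divide_right_mono) linarith+
        moreover have "real_of_int \<lfloor>m * x t\<rfloor> / m \<le> (m * x t) / m"
          using \<open>m > 0\<close> by (intro divide_right_mono) linarith+
        ultimately show "x t - 1 / real (Suc n) \<le> q n t" "q n t \<le> x t"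
          unfolding q_def m_def[symmetric] using \<open>m > 0\<close> by (simp_all add: diff_divide_distrib)
      qed
      then show "\<forall>\<^sub>F n in sequentially. x t - 1 / real (Suc n) \<le> q n t"
        "\<forall>\<^sub>F n in sequentially. q n t \<le> x t" by auto
      show "(\<lambda>n. x t - 1 / real (Suc n)) \<longlonglongrightarrow> x t"
        using tendsto_diff[OF tendsto_const LIMSEQ_Suc[OF lim_const_over_n[of 1]], of "x t"]
        by simp
    qed simp
    moreover have "isCont (\<lambda>y. g y (\<alpha> t)) (x t)"
      using cx[OF A[OF t]] by (simp add: continuous_on_eq_continuous_at)
    ultimately show ?thesis by (rule isCont_tendsto_compose[rotated])
  qed
  ultimately show ?thesis 
    by (rule borel_measurable_LIMSEQ_real[where u="\<lambda>n t. g (q n t) (\<alpha> t)", rotated])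
qed

lemma measurable_along:
  fixes h :: "int \<Rightarrow> real \<Rightarrow> 'a::metric_space \<Rightarrow> real"
  assumes i: "i \<in> N \<rightarrow>\<^sub>M count_space UNIV" "\<And>t. t \<in> space N \<Longrightarrow> i t = 1 \<or> i t = -1"
    and x: "x \<in> borel_measurable N" and \<alpha>: "\<alpha> \<in> borel_measurable N"
    and A: "\<And>t. t \<in> space N \<Longrightarrow> \<alpha> t \<in> A"
    and ca: "\<And>j y. j \<in> {1,-1} \<Longrightarrow> continuous_on A (h j y)"
    and cx: "\<And>j a. j \<in> {1,-1} \<Longrightarrow> a \<in> A \<Longrightarrow> continuous_on UNIV (\<lambda>y. h j y a)"
  shows "(\<lambda>t. h (i t) (x t) (\<alpha> t)) \<in> borel_measurable N"
proof -
  define g where "g j t = (if j \<in> {1,-1} then h j (x t) (\<alpha> t) else 0)" for j :: int and t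
  have "g j \<in> borel_measurable N" for j
  proof (cases "j \<in> {1,-1}")
    case True
    then have "g j = (\<lambda>t. h j (x t) (\<alpha> t))" by (auto simp: g_def)
    then show ?thesis using caratheodory_measurable[OF x \<alpha> A ca[OF True] cx[OF True]] by simp
  next
    case False
    then have "g j = (\<lambda>t. 0)" by (auto simp: g_def)
    then show ?thesis by simp
  qed
  then have "(\<lambda>t. g (i t) t) \<in> borel_measurable N"
    by (rule measurable_compose_countable[OF _ i(1)])
  then show ?thesis by (rule measurable_cong[THEN iffD1, rotated]) (use i(2) in \<open>auto simp: g_def\<close>)
qed

text \<open>
  The integral over the half-line with discount rate \<open>lam\<close>.
\<close>

definition discounted :: "real \<Rightarrow> (real \<Rightarrow> real) \<Rightarrow> real" where
  "discounted lam h = (LINT t:{0..}|lebesgue. exp (- lam * t) * h t)"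

lemma discounted_cong: "(\<And>t. t \<ge> 0 \<Longrightarrow> h t = h' t) \<Longrightarrow> discounted lam h = discounted lam h'"
  unfolding discounted_def by (intro set_lebesgue_integral_cong) auto

lemma discounted_nonneg: "(\<And>t. t \<ge> 0 \<Longrightarrow> h t \<ge> 0) \<Longrightarrow> discounted lam h \<ge> 0"
  unfolding discounted_def set_lebesgue_integral_def
  by (intro Bochner_Integration.integral_nonneg) (auto simp: indicator_def)

lemma discounted_integrable:
  fixes h :: "real \<Rightarrow> real" and K :: real
  assumes h: "h \<in> borel_measurable (lebesgue_on {0..})" and K: "\<And>t. t \<ge> 0 \<Longrightarrow> \<bar>h t\<bar> \<le> K" and lam: "lam > 0"
  shows "(\<lambda>t. exp (- lam * t) * h t) absolutely_integrable_on {0..}"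
proof (rule measurable_bounded_by_integrable_imp_absolutely_integrable[where g="\<lambda>t. exp (- lam * t) * K"])
  have "(\<lambda>t. exp (- lam * t)) \<in> borel_measurable (lebesgue_on {0..})"
    by (intro continuous_imp_measurable_on_sets_lebesgue continuous_intros) auto
  then show "(\<lambda>t. exp (- lam * t) * h t) \<in> borel_measurable (lebesgue_on {0..})" using h by measurable
  show "(\<lambda>t. exp (- lam * t) * K) integrable_on {0..}"
    using has_integral_exp_minus_to_infinity[OF lam, of 0] by (intro integrable_on_mult_left) blast
  fix t :: real assume "t \<in> {0..}"
  then show "norm (exp (- lam * t) * h t) \<le> exp (- lam * t) * K"
    using K[of t] by (simp add: abs_mult)
qed auto

lemma discounted_split:
  fixes h :: "real \<Rightarrow> real" and K :: real
  assumes h: "h \<in> borel_measurable (lebesgue_on {0..})" and K: "\<And>t. t \<ge> 0 \<Longrightarrow> \<bar>h t\<bar> \<le> K" and lam: "lam > 0"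
    and \<tau>: "\<tau> \<ge> 0"
  shows "discounted lam h = integral {0..\<tau>} (\<lambda>t. exp (- lam * t) * h t)
           + exp (- lam * \<tau>) * discounted lam (\<lambda>t. h (\<tau> + t))"
proof -
  let ?g = "\<lambda>t. exp (- lam * t) * h t"
  have g: "set_integrable lebesgue {0..} ?g" by (rule discounted_integrable[OF h K lam])
  have g1: "set_integrable lebesgue {0..\<tau>} ?g" by (rule set_integrable_subset[OF g]) auto
  have g2: "set_integrable lebesgue {\<tau>..} ?g" by (rule set_integrable_subset[OF g]) (use \<tau> in auto)
  have "{0..} = {0..\<tau>} \<union> {\<tau>..}" using \<tau> by auto
  then have "discounted lam h = (LINT t:{0..\<tau>} \<union> {\<tau>..}|lebesgue. ?g t)" by (simp add: discounted_def)
  also have "\<dots> = (LINT t:{0..\<tau>}|lebesgue. ?g t) + (LINT t:{\<tau>..}|lebesgue. ?g t)"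
  proof (rule set_integral_Un_AE[OF _ _ _ g1 g2])
    have "AE t in lebesgue. t \<noteq> \<tau>" by (intro AE_completion AE_lborel_singleton)
    then show "AE t in lebesgue. \<not> (t \<in> {0..\<tau>} \<and> t \<in> {\<tau>..})" by eventually_elim auto
  qed auto
  also have "(LINT t:{0..\<tau>}|lebesgue. ?g t) = integral {0..\<tau>} ?g"
    by (rule set_lebesgue_integral_eq_integral(2)[OF g1])
  also have "(LINT t:{\<tau>..}|lebesgue. ?g t) = exp (- lam * \<tau>) * discounted lam (\<lambda>t. h (\<tau> + t))"
  proof -
    let ?G = "\<lambda>t. indicator {\<tau>..} t *\<^sub>R ?g t"
    have meas: "(+) \<tau> \<in> lebesgue \<rightarrow>\<^sub>M lebesgue" using lebesgue_affine_measurable[of "\<lambda>_. 1" \<tau>] by simp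
    have G: "?G \<in> borel_measurable lebesgue" using g2 unfolding set_integrable_def by auto
    have "lebesgue = distr lebesgue lebesgue ((+) \<tau>)"
      using lebesgue_real_affine[of 1 \<tau>] by (simp add: density_1)
    then have "(\<integral>t. ?G t \<partial>lebesgue) = (\<integral>t. ?G t \<partial>distr lebesgue lebesgue ((+) \<tau>))" by simp
    also have "\<dots> = (\<integral>t. ?G (\<tau> + t) \<partial>lebesgue)" by (rule integral_distr[OF meas G])
    also have "(\<lambda>t. ?G (\<tau> + t)) = (\<lambda>t. exp (- lam * \<tau>) * (indicator {0..} t *\<^sub>R (exp (- lam * t) * h (\<tau> + t))))"
      by (auto simp: indicator_def fun_eq_iff exp_add[symmetric] algebra_simps)
    finally show ?thesis unfolding discounted_def set_lebesgue_integral_def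
      by (simp only: integral_mult_right_zero)
  qed
  finally show ?thesis .
qed

section \<open>Expansion of the discount factor and one-sided differentials\<close>

lemma exp_neg_bounds:
  fixes u :: real assumes "u \<ge> 0"
  shows "\<bar>exp (- u) - 1\<bar> \<le> u" "\<bar>exp (- u) - 1 + u\<bar> \<le> u\<^sup>2"
proof -
  have 1: "1 - u \<le> exp (- u)" "exp (-u) \<le> 1" using exp_ge_add_one_self[of "-u"] assms by auto
  have "(1 - u + u\<^sup>2) * (1 + u) = 1 + u ^ 3" by (simp add: algebra_simps power2_eq_square power3_eq_cube)
  then have "1 / (1 + u) \<le> 1 - u + u\<^sup>2" using assms by (simp add: pos_divide_le_eq)
  moreover have "exp (- u) \<le> 1 / (1 + u)"
    using exp_ge_add_one_self[of u] assms by (simp add: exp_minus field_simps)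
  ultimately have 2: "exp (- u) \<le> 1 - u + u\<^sup>2" by linarith
  show "\<bar>exp (- u) - 1\<bar> \<le> u" using 1 assms by linarith
  show "\<bar>exp (- u) - 1 + u\<bar> \<le> u\<^sup>2" using 1 2 by (simp add: abs_le_iff)
qed

lemma discount_expand:
  fixes v w u :: real assumes "u \<ge> 0"
  shows "\<bar>exp (- u) * (v + w) - (v - u * v + w)\<bar> \<le> \<bar>v\<bar> * u\<^sup>2 + u * \<bar>w\<bar>"
proof -
  have "exp (- u) * (v + w) - (v - u * v + w) = v * (exp (- u) - 1 + u) + (exp (- u) - 1) * w"
    by (simp add: algebra_simps)
  also have "\<bar>\<dots>\<bar> \<le> \<bar>v * (exp (- u) - 1 + u)\<bar> + \<bar>(exp (- u) - 1) * w\<bar>" by (rule abs_triangle_ineq)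
  also have "\<dots> = \<bar>v\<bar> * \<bar>exp (- u) - 1 + u\<bar> + \<bar>exp (- u) - 1\<bar> * \<bar>w\<bar>" by (simp only: abs_mult)
  also have "\<dots> \<le> \<bar>v\<bar> * u\<^sup>2 + u * \<bar>w\<bar>"
    by (intro add_mono mult_left_mono mult_right_mono exp_neg_bounds assms) auto
  finally show ?thesis .
qed

text \<open>
  Test functions enter the proof only through the first-order expansions of \<open>V\<close> that they imply.
\<close>

lemma superdifferential:
  fixes V \<phi> :: "real \<Rightarrow> real"
  assumes max: "local_max_at (\<lambda>y. V y - \<phi> y) x0" and \<phi>: "(\<phi> has_real_derivative p) (at x0)" and \<kappa>: "\<kappa> > 0"
  shows "\<forall>\<^sub>F y in nhds x0. V y \<le> V x0 + p * (y - x0) + \<kappa> * \<bar>y - x0\<bar>"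
proof -
  have "\<exists>d>0. \<forall>y. norm (y - x0) < d \<longrightarrow> norm (\<phi> y - \<phi> x0 - p * (y - x0)) \<le> \<kappa> * norm (y - x0)"
    using \<phi> \<kappa> unfolding has_field_derivative_def has_derivative_at_alt by blast
  then have "\<forall>\<^sub>F y in nhds x0. \<bar>\<phi> y - \<phi> x0 - p * (y - x0)\<bar> \<le> \<kappa> * \<bar>y - x0\<bar>"
    unfolding eventually_nhds_metric dist_real_def by simp
  with max[unfolded local_max_at_def] show ?thesis by eventually_elim (simp add: abs_le_iff)
qed

lemma subdifferential:
  fixes V \<phi> :: "real \<Rightarrow> real"
  assumes min: "local_min_at (\<lambda>y. V y - \<phi> y) x0" and \<phi>: "(\<phi> has_real_derivative p) (at x0)" and \<kappa>: "\<kappa> > 0"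
  shows "\<forall>\<^sub>F y in nhds x0. V x0 + p * (y - x0) - \<kappa> * \<bar>y - x0\<bar> \<le> V y"
proof -
  have "\<exists>d>0. \<forall>y. norm (y - x0) < d \<longrightarrow> norm (\<phi> y - \<phi> x0 - p * (y - x0)) \<le> \<kappa> * norm (y - x0)"
    using \<phi> \<kappa> unfolding has_field_derivative_def has_derivative_at_alt by blast
  then have "\<forall>\<^sub>F y in nhds x0. \<bar>\<phi> y - \<phi> x0 - p * (y - x0)\<bar> \<le> \<kappa> * \<bar>y - x0\<bar>"
    unfolding eventually_nhds_metric dist_real_def by simp
  with min[unfolded local_min_at_def] show ?thesis by eventually_elim (simp add: abs_le_iff)
qed

lemma C1_has_derivative:
  assumes "\<phi> C1_differentiable_on S" "x \<in> S"
  shows "(\<phi> has_real_derivative deriv \<phi> x) (at x)"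
proof -
  obtain D where "(\<phi> has_real_derivative D) (at x)"
    using assms unfolding C1_differentiable_on_def has_real_derivative_iff_has_vector_derivative by blast
  then show ?thesis using DERIV_imp_deriv by blast
qed

section \<open>The control problem and its solutions\<close>

text \<open>
  The data, already extended to the whole line by \<open>const_ext\<close>. The constants \<open>M\<close> and \<open>K\<close> bound the
  dynamics and the costs. Controllability is quantified by \<open>c\<close>: on each branch \<open>i\<close> and for each
  direction \<open>j\<close> there is a control with speed at least \<open>2 c\<close> at the junction, hence at least \<open>c\<close>
  nearby.
\<close>

locale thermostat_problem =
  fixes A :: "'a::metric_space set" and f l :: "int \<Rightarrow> real \<Rightarrow> 'a \<Rightarrow> real"
    and lam L M K c :: real and \<omega> :: "real \<Rightarrow> real"
  assumes lam_pos: "lam > 0" and L_pos: "L > 0" and c_pos: "c > 0"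
    and F_bound: "\<And>i x a. i \<in> {1,-1} \<Longrightarrow> a \<in> A \<Longrightarrow> \<bar>const_ext f i x a\<bar> \<le> M"
    and F_lip: "\<And>i x y a. i \<in> {1,-1} \<Longrightarrow> a \<in> A \<Longrightarrow>
      \<bar>const_ext f i x a - const_ext f i y a\<bar> \<le> L * \<bar>x - y\<bar>"
    and F_cont: "\<And>i x. i \<in> {1,-1} \<Longrightarrow> continuous_on A (const_ext f i x)"
    and G_nonneg: "\<And>i x a. i \<in> {1,-1} \<Longrightarrow> a \<in> A \<Longrightarrow> const_ext l i x a \<ge> 0"
    and G_le: "\<And>i x a. i \<in> {1,-1} \<Longrightarrow> a \<in> A \<Longrightarrow> const_ext l i x a \<le> K"
    and G_mod: "\<And>i x y a. i \<in> {1,-1} \<Longrightarrow> a \<in> A \<Longrightarrow>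
      \<bar>const_ext l i x a - const_ext l i y a\<bar> \<le> \<omega> \<bar>x - y\<bar>"
    and G_cont: "\<And>i x. i \<in> {1,-1} \<Longrightarrow> continuous_on A (const_ext l i x)"
    and omega_mono: "\<And>r s. 0 \<le> r \<Longrightarrow> r \<le> s \<Longrightarrow> \<omega> r \<le> \<omega> s"
    and omega_lim: "(\<omega> \<longlongrightarrow> 0) (at_right 0)"
    and control: "\<And>i j. i \<in> {1,-1} \<Longrightarrow> j \<in> {1,-1} \<Longrightarrow>
      \<exists>a\<in>A. real_of_int j * const_ext f i 0 a \<ge> 2 * c"
begin

abbreviation "F \<equiv> const_ext f"
abbreviation "G \<equiv> const_ext l"
abbreviation "Veps \<equiv> V_eps A f l lam"

lemma M_pos: "M > 0" and K_nonneg: "K \<ge> 0"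
proof -
  obtain a where a: "a \<in> A" "real_of_int 1 * F 1 0 a \<ge> 2 * c" using control[of 1 1] by auto
  with F_bound[of 1 a 0] c_pos show "M > 0" by simp
  show "K \<ge> 0" using G_nonneg[of 1 a 0] G_le[of 1 a 0] a by simp
qed

lemma F_cont_x: "i \<in> {1,-1} \<Longrightarrow> a \<in> A \<Longrightarrow> continuous_on S (\<lambda>y. F i y a)"
  by (rule lipschitz_on_continuous_on[of L])
     (use F_lip L_pos in \<open>auto simp: lipschitz_on_def dist_real_def\<close>)

lemma G_cont_x:
  assumes "i \<in> {1,-1}" "a \<in> A" shows "continuous_on S (\<lambda>y. G i y a)"
proof (rule continuous_on_subset[of UNIV])
  have "((\<lambda>y. G i y a) \<longlongrightarrow> G i x a) (at x)" for x
  proof (rule Lim_null[THEN iffD2], rule Lim_null_comparison)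
    show "\<forall>\<^sub>F y in at x. norm (G i y a - G i x a) \<le> \<omega> \<bar>y - x\<bar>" using G_mod assms by auto
    have "filterlim (\<lambda>y. \<bar>y - x\<bar>) (at_right 0) (at x)"
      unfolding filterlim_at by (auto simp: eventually_at_filter intro!: tendsto_eq_intros)
    then show "((\<lambda>y. \<omega> \<bar>y - x\<bar>) \<longlongrightarrow> 0) (at x)"
      using omega_lim by (rule filterlim_compose[rotated])
  qed
  then show "continuous_on UNIV (\<lambda>y. G i y a)" by (simp add: continuous_on_def)
qed auto

lemma omega_nonneg: "0 \<le> r \<Longrightarrow> \<omega> r \<ge> 0"
proof -
  assume r: "0 \<le> r"
  obtain a where "a \<in> A" using control[of 1 1] by auto
  then show ?thesis using G_mod[of 1 a r 0] r by simp
qed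

text \<open>
  An admissible control together with a solution of the delayed system that it generates.
\<close>

definition solution where
  "solution \<epsilon> x0 i0 \<alpha> x i \<longleftrightarrow> \<alpha> \<in> controls A \<and> is_solution f \<epsilon> x0 i0 \<alpha> x i"

lemma solutionD:
  assumes "solution \<epsilon> x0 i0 \<alpha> x i"
  shows "\<alpha> \<in> borel_measurable (lebesgue_on {0..})" "\<And>t. t \<ge> 0 \<Longrightarrow> \<alpha> t \<in> A"
    "continuous_on {0..} x" "x 0 = x0" "i 0 = i0" "thermostat \<epsilon> x i0 i"
    "\<And>t. t \<ge> 0 \<Longrightarrow> i t \<in> {1,-1}" "\<And>t. t \<ge> 0 \<Longrightarrow> real_of_int (i t) * x t \<ge> -\<epsilon>"
proof -
  let ?\<phi> = "\<lambda>s. F (i s) (x s) (\<alpha> s)"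
  have "set_integrable lebesgue {0..0} ?\<phi>" "x 0 = x0 + (LINT s:{0..0}|lebesgue. ?\<phi> s)"
    using assms unfolding solution_def is_solution_def by (metis order_refl)+
  then show "x 0 = x0"
    using set_lebesgue_integral_eq_integral(2)[of "{0..0}" ?\<phi>] integral_refl[of 0 ?\<phi>] by simp
qed (use assms in \<open>auto simp: solution_def controls_def is_solution_def thermostat_iff\<close>)

lemma solution_increment:
  assumes S: "solution \<epsilon> x0 i0 \<alpha> x i" and st: "0 \<le> s" "s \<le> t"
  shows "((\<lambda>r. F (i r) (x r) (\<alpha> r)) has_integral x t - x s) {s..t}"
proof -
  let ?\<phi> = "\<lambda>r. F (i r) (x r) (\<alpha> r)"
  have I: "?\<phi> integrable_on {0..t}" "x t = x0 + integral {0..t} ?\<phi>" if "t \<ge> 0" for t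
    using S that set_lebesgue_integral_eq_integral[of "{0..t}" ?\<phi>]
    unfolding solution_def is_solution_def by auto
  have "integral {0..s} ?\<phi> + integral {s..t} ?\<phi> = integral {0..t} ?\<phi>"
    using st I(1)[of t] by (intro Henstock_Kurzweil_Integration.integral_combine) auto
  moreover have "?\<phi> integrable_on {s..t}"
    by (rule integrable_on_subinterval[OF I(1)[of t]]) (use st in auto)
  ultimately show ?thesis using I(2)[of s] I(2)[of t] st
    by (simp add: has_integral_iff)
qed

lemma solution_lip:
  assumes S: "solution \<epsilon> x0 i0 \<alpha> x i" and st: "0 \<le> s" "0 \<le> t"
  shows "\<bar>x s - x t\<bar> \<le> M * \<bar>s - t\<bar>"
proof -
  have *: "\<bar>x t - x s\<bar> \<le> M * (t - s)" if "0 \<le> s" "s \<le> t" for s t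
  proof -
    have "norm (x t - x s) \<le> M * Henstock_Kurzweil_Integration.content {s..t}"
    proof (rule has_integral_bound_real[OF _ finite.emptyI solution_increment[OF S that]])
      show "norm (F (i r) (x r) (\<alpha> r)) \<le> M" if "r \<in> {s..t} - {}" for r
        using F_bound[OF solutionD(7,2)[OF S], of r r] that \<open>0 \<le> s\<close> by simp
    qed (use M_pos in simp)
    then show ?thesis using that by simp
  qed
  show ?thesis using *[of s t] *[of t s] st by (cases "s \<le> t") (auto simp: abs_minus_commute)
qed

lemma solution_output_measurable:
  assumes "solution \<epsilon> x0 i0 \<alpha> x i" "\<epsilon> > 0"
  shows "i \<in> lebesgue_on {0..} \<rightarrow>\<^sub>M count_space UNIV"
  using thermostat_measurable[OF solutionD(6)[OF assms(1)] assms(2) M_pos] solution_lip[OF assms(1)] by blast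

lemma running_measurable:
  assumes "\<alpha> \<in> controls A" "continuous_on {0..} x" "i \<in> lebesgue_on {0..} \<rightarrow>\<^sub>M count_space UNIV"
    "\<And>t. t \<ge> 0 \<Longrightarrow> i t \<in> {1,-1}"
  shows "(\<lambda>t. F (i t) (x t) (\<alpha> t)) \<in> borel_measurable (lebesgue_on {0..})"
    and "(\<lambda>t. G (i t) (x t) (\<alpha> t)) \<in> borel_measurable (lebesgue_on {0..})"
proof -
  have x: "x \<in> borel_measurable (lebesgue_on {0..})"
    using assms(2) by (intro continuous_imp_measurable_on_sets_lebesgue) auto
  show "(\<lambda>t. F (i t) (x t) (\<alpha> t)) \<in> borel_measurable (lebesgue_on {0..})"
    by (rule measurable_along[OF assms(3) _ x, where A=A])
       (use assms F_cont F_cont_x in \<open>auto simp: controls_def\<close>)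
  show "(\<lambda>t. G (i t) (x t) (\<alpha> t)) \<in> borel_measurable (lebesgue_on {0..})"
    by (rule measurable_along[OF assms(3) _ x, where A=A])
       (use assms G_cont G_cont_x in \<open>auto simp: controls_def\<close>)
qed

lemma solutionI:
  assumes "\<alpha> \<in> controls A" "continuous_on {0..} x" "i \<in> lebesgue_on {0..} \<rightarrow>\<^sub>M count_space UNIV"
    and th: "thermostat \<epsilon> x i0 i"
    and int: "\<And>t. t \<ge> 0 \<Longrightarrow> ((\<lambda>s. F (i s) (x s) (\<alpha> s)) has_integral x t - x0) {0..t}"
  shows "solution \<epsilon> x0 i0 \<alpha> x i"
  unfolding solution_def is_solution_def
proof (intro conjI allI impI)
  fix t :: real assume t: "t \<ge> 0"
  have i: "i t \<in> {1,-1}" if "t \<ge> 0" for t using th that unfolding thermostat_iff by auto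
  show *: "set_integrable lebesgue {0..t} (\<lambda>s. F (i s) (x s) (\<alpha> s))"
  proof (rule measurable_bounded_by_integrable_imp_absolutely_integrable[where g="\<lambda>_. M"])
    show "(\<lambda>s. F (i s) (x s) (\<alpha> s)) \<in> borel_measurable (lebesgue_on {0..t})"
      by (rule measurable_restrict_mono[OF running_measurable(1)[OF assms(1-3)]]) (use i in auto)
    show "norm (F (i s) (x s) (\<alpha> s)) \<le> M" if "s \<in> {0..t}" for s
      using F_bound[OF i[of s]] assms(1) that by (auto simp: controls_def)
  qed auto
  show "x t = x0 + (LINT s:{0..t}|lebesgue. F (i s) (x s) (\<alpha> s))"
    using int[OF t] by (simp add: set_lebesgue_integral_eq_integral(2)[OF *] integral_unique)
qed (use assms in auto)

lemma cost_discounted: "cost l lam \<alpha> x i = discounted lam (\<lambda>t. G (i t) (x t) (\<alpha> t))"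
  unfolding cost_def discounted_def ..

lemma solution_shift:
  assumes S: "solution \<epsilon> x0 i0 \<alpha> x i" and \<epsilon>: "\<epsilon> > 0" and \<tau>: "\<tau> \<ge> 0"
  shows "solution \<epsilon> (x \<tau>) (i \<tau>) (\<lambda>t. \<alpha> (\<tau> + t)) (\<lambda>t. x (\<tau> + t)) (\<lambda>t. i (\<tau> + t))"
proof (rule solutionI)
  note D = solutionD[OF S]
  show "(\<lambda>t. \<alpha> (\<tau> + t)) \<in> controls A"
    using measurable_translate[OF D(1) \<tau>] D(2) \<tau> by (auto simp: controls_def)
  show "continuous_on {0..} (\<lambda>t. x (\<tau> + t))"
    using \<tau> by (intro continuous_on_compose2[OF D(3)] continuous_intros) auto
  show "(\<lambda>t. i (\<tau> + t)) \<in> lebesgue_on {0..} \<rightarrow>\<^sub>M count_space UNIV"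
    by (rule measurable_translate[OF solution_output_measurable[OF S \<epsilon>] \<tau>])
  show "thermostat \<epsilon> (\<lambda>t. x (\<tau> + t)) (i \<tau>) (\<lambda>t. i (\<tau> + t))"
    by (rule thermostat_shift[OF D(6) \<tau>])
  fix t :: real assume "t \<ge> 0"
  then show "((\<lambda>s. F (i (\<tau> + s)) (x (\<tau> + s)) (\<alpha> (\<tau> + s))) has_integral x (\<tau> + t) - x \<tau>) {0..t}"
    using solution_increment[OF S \<tau>, of "\<tau> + t"]
      has_integral_shift_Icc_real[of "\<lambda>r. F (i r) (x r) (\<alpha> r)" \<tau> "x (\<tau> + t) - x \<tau>" 0 t]
    by (simp add: o_def add.commute)
qed

lemma solution_running:
  assumes S: "solution \<epsilon> x0 i0 \<alpha> x i" and \<epsilon>: "\<epsilon> > 0"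
  shows "(\<lambda>t. G (i t) (x t) (\<alpha> t)) \<in> borel_measurable (lebesgue_on {0..})"
    and "\<And>t. t \<ge> 0 \<Longrightarrow> \<bar>G (i t) (x t) (\<alpha> t)\<bar> \<le> K"
    and "\<And>t. t \<ge> 0 \<Longrightarrow> 0 \<le> G (i t) (x t) (\<alpha> t)"
proof -
  note D = solutionD[OF S]
  show "(\<lambda>t. G (i t) (x t) (\<alpha> t)) \<in> borel_measurable (lebesgue_on {0..})"
    by (rule running_measurable(2)) (use S D solution_output_measurable[OF S \<epsilon>] in \<open>auto simp: solution_def\<close>)
  show *: "\<And>t. t \<ge> 0 \<Longrightarrow> 0 \<le> G (i t) (x t) (\<alpha> t)" using D G_nonneg by blast
  show "\<And>t. t \<ge> 0 \<Longrightarrow> \<bar>G (i t) (x t) (\<alpha> t)\<bar> \<le> K" using * D G_le by (metis abs_of_nonneg)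
qed

lemma cost_split:
  assumes S: "solution \<epsilon> x0 i0 \<alpha> x i" and \<epsilon>: "\<epsilon> > 0" and \<tau>: "\<tau> \<ge> 0"
  shows "cost l lam \<alpha> x i = integral {0..\<tau>} (\<lambda>t. exp (- lam * t) * G (i t) (x t) (\<alpha> t))
      + exp (- lam * \<tau>) * cost l lam (\<lambda>t. \<alpha> (\<tau> + t)) (\<lambda>t. x (\<tau> + t)) (\<lambda>t. i (\<tau> + t))"
  unfolding cost_discounted
  using discounted_split[OF solution_running(1,2)[OF S \<epsilon>] lam_pos \<tau>] by simp

lemma cost_nonneg: "solution \<epsilon> x0 i0 \<alpha> x i \<Longrightarrow> \<epsilon> > 0 \<Longrightarrow> cost l lam \<alpha> x i \<ge> 0"
  unfolding cost_discounted by (intro discounted_nonneg solution_running(3))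

lemma Veps_eq_Inf: "Veps \<epsilon> x0 i0 = Inf {cost l lam \<alpha> x i |\<alpha> x i. solution \<epsilon> x0 i0 \<alpha> x i}"
  unfolding V_eps_def solution_def ..

lemma Veps_le_cost:
  assumes "solution \<epsilon> x0 i0 \<alpha> x i" "\<epsilon> > 0" shows "Veps \<epsilon> x0 i0 \<le> cost l lam \<alpha> x i"
  unfolding Veps_eq_Inf
proof (rule cInf_lower)
  show "bdd_below {cost l lam \<alpha> x i |\<alpha> x i. solution \<epsilon> x0 i0 \<alpha> x i}"
    using cost_nonneg assms(2) by (intro bdd_belowI[of _ 0]) blast
qed (use assms in blast)

text \<open>
  From every coherent state there is a solution that never switches: a control pointing into the branch
  at its threshold keeps the trajectory there forever, by \<open>ode_barrier_sign\<close>.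
\<close>

lemma solution_exists:
  assumes i: "i \<in> {1,-1}" and x0: "real_of_int i * x0 \<ge> -\<epsilon>" and \<epsilon>: "\<epsilon> > 0" "L * \<epsilon> \<le> 2 * c"
  shows "\<exists>\<alpha> x k. solution \<epsilon> x0 i \<alpha> x k"
proof -
  obtain a where a: "a \<in> A" "real_of_int i * F i 0 a \<ge> 2 * c" using control[OF i i] by blast
  obtain x where x: "x 0 = x0" "\<And>t. t \<ge> 0 \<Longrightarrow> (x has_real_derivative F i (x t) a) (at t within {0..})"
    using ode_exists[OF F_lip[OF i a(1)] L_pos F_bound[OF i a(1)]] by blast
  have s: "real_of_int i = 1 \<or> real_of_int i = -1" using i by auto
  \<comment> \<open>the threshold of branch \<open>i\<close>\<close>
  define m where "m = - real_of_int i * \<epsilon>"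
  have m: "real_of_int i * m = - \<epsilon>" "\<bar>m\<bar> = \<epsilon>" using s \<epsilon> by (auto simp: m_def)
  have "\<bar>F i m a - F i 0 a\<bar> \<le> 2 * c" using F_lip[OF i a(1), of m 0] m \<epsilon> by simp
  then have g: "real_of_int i * F i m a \<ge> 0" using a s by auto
  have ge: "real_of_int i * x t \<ge> -\<epsilon>" if "t \<ge> 0" for t
    using ode_barrier_sign[OF F_lip[OF i a(1)] x(2) s g _ that] x0 x(1) m by simp
  have "solution \<epsilon> x0 i (\<lambda>_. a) x (\<lambda>_. i)"
  proof (rule solutionI)
    show "(\<lambda>_. a) \<in> controls A" using a by (simp add: controls_def)
    show "continuous_on {0..} x" by (rule ode_continuous[OF x(2)])
    show "thermostat \<epsilon> x i (\<lambda>_. i)" using ge i by (auto simp: thermostat_iff)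
    show "((\<lambda>s. F i (x s) a) has_integral x t - x0) {0..t}" if "t \<ge> 0" for t
      using ode_has_integral[OF x(2), of 0 t] x(1) that by simp
  qed auto
  then show ?thesis by blast
qed

lemma Veps_approx:
  assumes i: "i \<in> {1,-1}" and x0: "real_of_int i * x0 \<ge> -\<epsilon>" and \<epsilon>: "\<epsilon> > 0" "L * \<epsilon> \<le> 2 * c"
    and \<eta>: "\<eta> > 0"
  shows "\<exists>\<alpha> x k. solution \<epsilon> x0 i \<alpha> x k \<and> cost l lam \<alpha> x k < Veps \<epsilon> x0 i + \<eta>"
proof -
  have "Inf {cost l lam \<alpha> x k |\<alpha> x k. solution \<epsilon> x0 i \<alpha> x k} < Veps \<epsilon> x0 i + \<eta>"
    using \<eta> by (simp add: Veps_eq_Inf)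
  from cInf_lessD[OF _ this] solution_exists[OF i x0 \<epsilon>] show ?thesis by blast
qed

lemma Veps_nonneg:
  assumes i: "i \<in> {1,-1}" and x0: "real_of_int i * x0 \<ge> -\<epsilon>" and \<epsilon>: "\<epsilon> > 0" "L * \<epsilon> \<le> 2 * c"
  shows "Veps \<epsilon> x0 i \<ge> 0"
  unfolding Veps_eq_Inf
  by (rule cInf_greatest) (use solution_exists[OF i x0 \<epsilon>] cost_nonneg \<epsilon> in blast)+

section \<open>Dynamic programming inequalities\<close>

text \<open>
  A trajectory on branch \<open>j\<close> with constant control is prolonged by a given solution. Its initial output
  may be the opposite one, provided that the trajectory starts coherently with that output and exceeds
  the threshold towards \<open>j\<close> at arbitrarily small times, so that the output switches immediately.
\<close>

lemma solution_glue:
  assumes j: "j \<in> {1,-1}" and a: "a \<in> A" and \<epsilon>: "\<epsilon> > 0" and T: "T \<ge> 0"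
    and x: "\<And>t. t \<ge> 0 \<Longrightarrow> (x has_real_derivative F j (x t) a) (at t within {0..})" and x0: "x 0 = x0"
    and coh: "\<And>t. 0 \<le> t \<Longrightarrow> t \<le> T \<Longrightarrow> real_of_int j * x t \<ge> -\<epsilon>"
    and start: "i0 = j \<or> i0 = -j \<and> T > 0 \<and> real_of_int i0 * x0 \<ge> -\<epsilon> \<and>
      (\<forall>t\<in>{0<..T}. \<exists>r\<in>{0<..t}. real_of_int j * x r > \<epsilon>)"
    and tail: "solution \<epsilon> (x T) j \<beta> z k"
  shows "\<exists>\<alpha>' x' i'. solution \<epsilon> x0 i0 \<alpha>' x' i' \<and>
    cost l lam \<alpha>' x' i' = integral {0..T} (\<lambda>t. exp (- lam * t) * G j (x t) a) + exp (- lam * T) * cost l lam \<beta> z k"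
proof -
  note D = solutionD[OF tail]
  \<comment> \<open>the output of the first piece: the old one persists at time \<open>0\<close> only\<close>
  define p where "p = (\<lambda>t::real. if t = 0 then i0 else j)"
  define \<alpha>' where "\<alpha>' = (\<lambda>t. if t < T then a else \<beta> (t - T))"
  define x' where "x' = (\<lambda>t. if t < T then x t else z (t - T))"
  define i' where "i' = (\<lambda>t. if t < T then p t else k (t - T))"
  have pT: "p T = j" using start by (auto simp: p_def)
  have x'_le: "x' t = x t" if "t \<le> T" for t using that D(4) by (cases "t = T") (auto simp: x'_def)
  have x'_eq: "x' = (\<lambda>t. if t \<le> T then x t else z (t - T))"
    using D(4) by (auto simp: x'_def fun_eq_iff)
  have i'_eq: "i' = (\<lambda>t. if t \<le> T then p t else k (t - T))"
    using D(5) pT by (auto simp: i'_def fun_eq_iff)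
  have ij: "i0 \<in> {1,-1}" using start j by auto
  have S: "solution \<epsilon> x0 i0 \<alpha>' x' i'"
  proof (rule solutionI)
    have "(\<lambda>_. a) \<in> lebesgue_on {0..} \<rightarrow>\<^sub>M borel" by simp
    from measurable_glue[OF this D(1) T] show "\<alpha>' \<in> controls A"
      using a D(2) by (auto simp: controls_def \<alpha>'_def)
    have "p \<in> lebesgue_on {0..} \<rightarrow>\<^sub>M count_space UNIV"
      unfolding p_def by (intro measurable_If) (auto simp: sets_restrict_space intro!: image_eqI[of _ _ "{0}"])
    from measurable_glue[OF this solution_output_measurable[OF tail \<epsilon>] T]
    show "i' \<in> lebesgue_on {0..} \<rightarrow>\<^sub>M count_space UNIV" unfolding i'_def .
    have "continuous_on ({0..T} \<union> {T..}) (\<lambda>t. if t \<le> T then x t else z (t - T))"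
    proof (rule continuous_on_cases)
      show "continuous_on {0..T} x" by (rule continuous_on_subset[OF ode_continuous[OF x]]) auto
      show "continuous_on {T..} (\<lambda>t. z (t - T))"
        by (intro continuous_on_compose2[OF D(3)] continuous_intros) auto
    qed (use D(4) in auto)
    moreover have "{0..T} \<union> {T..} = {0..}" using T by auto
    ultimately show "continuous_on {0..} x'" unfolding x'_eq by simp
    have "thermostat \<epsilon> (\<lambda>t. if t \<le> T then x t else z (t - T)) i0 (\<lambda>t. if t \<le> T then p t else k (t - T))"
    proof (rule thermostat_glue[OF T])
      show "thermostat \<epsilon> z (p T) k" using D(6) pT by simp
      show "p 0 = i0" by (simp add: p_def)
      show "(p t = 1 \<or> p t = -1) \<and> real_of_int (p t) * x t \<ge> -\<epsilon>" if "0 \<le> t" "t \<le> T" for t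
        using that coh[of t] start ij j x0 by (auto simp: p_def)
      fix s t assume st: "0 \<le> s" "s < t" "t \<le> T" "p s = - p t"
      then have "p t = j" by (simp add: p_def)
      with st j have "s = 0" "i0 = - j" by (auto simp: p_def split: if_splits)
      moreover from this have "i0 \<noteq> j" using j by auto
      ultimately have "\<exists>r\<in>{0<..t}. real_of_int j * x r > \<epsilon>" using start st by auto
      with \<open>s = 0\<close> \<open>p t = j\<close> show "\<exists>r\<in>{s<..t}. real_of_int (p t) * x r > \<epsilon>" by simp
    qed
    then show "thermostat \<epsilon> x' i0 i'" unfolding x'_eq i'_eq .
    let ?\<phi> = "\<lambda>s. F (i' s) (x' s) (\<alpha>' s)"
    have head: "(?\<phi> has_integral x t - x0) {0..t}" if "0 \<le> t" "t \<le> T" for t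
    proof (rule has_integral_spike_finite[of "{0,T}"])
      show "((\<lambda>s. F j (x s) a) has_integral x t - x0) {0..t}"
        using ode_has_integral[OF x, of 0 t] that x0 by simp
      show "?\<phi> s = F j (x s) a" if "s \<in> {0..t} - {0,T}" for s
        using that \<open>t \<le> T\<close> by (auto simp: i'_def p_def x'_def \<alpha>'_def)
    qed simp
    show "(?\<phi> has_integral x' t - x0) {0..t}" if "t \<ge> 0" for t
    proof (cases "t \<le> T")
      case True
      then show ?thesis using head[OF that] x'_le by simp
    next
      case False
      have "((?\<phi> \<circ> (+) T) has_integral z (t - T) - x T) {0..t - T}"
      proof (rule has_integral_eq)
        show "((\<lambda>s. F (k s) (z s) (\<beta> s)) has_integral z (t - T) - x T) {0..t - T}"
          using solution_increment[OF tail, of 0 "t - T"] False D(4) by simp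
        show "F (k s) (z s) (\<beta> s) = (?\<phi> \<circ> (+) T) s" if "s \<in> {0..t - T}" for s
          using that by (simp add: i'_def x'_def \<alpha>'_def)
      qed
      then have "(?\<phi> has_integral z (t - T) - x T) {T..t}"
        using has_integral_shift_Icc_real[of ?\<phi> T "z (t - T) - x T" 0 "t - T"] by simp
      from has_integral_combine[OF T _ head[OF T order_refl] this] False
      show ?thesis by (simp add: x'_def)
    qed
  qed
  have "integral {0..T} (\<lambda>t. exp (- lam * t) * G (i' t) (x' t) (\<alpha>' t))
    = integral {0..T} (\<lambda>t. exp (- lam * t) * G j (x t) a)"
    by (rule integral_spike[of "{0,T}"]) (auto simp: i'_def p_def x'_def \<alpha>'_def)
  moreover have "cost l lam (\<lambda>t. \<alpha>' (T + t)) (\<lambda>t. x' (T + t)) (\<lambda>t. i' (T + t)) = cost l lam \<beta> z k"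
    unfolding cost_discounted by (intro discounted_cong) (simp add: i'_def x'_def \<alpha>'_def)
  ultimately show ?thesis using S cost_split[OF S \<epsilon> T] by auto
qed

text \<open>
  Upper inequality. The number \<open>z\<close> is a reference point for the coefficients, from which the trajectory
  stays within \<open>\<rho>\<close>; the number \<open>p\<close> is arbitrary (the slope of a test function in the applications). The
  running cost is discounted by a factor at most \<open>1\<close> and \<open>x T - x0\<close> is the integral of the velocity.
\<close>

lemma Veps_constant_control:
  assumes j: "j \<in> {1,-1}" and a: "a \<in> A" and \<epsilon>: "\<epsilon> > 0" "L * \<epsilon> \<le> 2 * c" and T: "T \<ge> 0"
    and x: "\<And>t. t \<ge> 0 \<Longrightarrow> (x has_real_derivative F j (x t) a) (at t within {0..})" and x0: "x 0 = x0"
    and coh: "\<And>t. 0 \<le> t \<Longrightarrow> t \<le> T \<Longrightarrow> real_of_int j * x t \<ge> -\<epsilon>"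
    and start: "i0 = j \<or> i0 = -j \<and> T > 0 \<and> real_of_int i0 * x0 \<ge> -\<epsilon> \<and>
      (\<forall>t\<in>{0<..T}. \<exists>r\<in>{0<..t}. real_of_int j * x r > \<epsilon>)"
    and near: "\<And>t. 0 \<le> t \<Longrightarrow> t \<le> T \<Longrightarrow> \<bar>x t - z\<bar> \<le> \<rho>"
  shows "Veps \<epsilon> x0 i0 \<le> T * (G j z a + p * F j z a + \<omega> \<rho> + \<bar>p\<bar> * L * \<rho>) - p * (x T - x0)
    + exp (- lam * T) * Veps \<epsilon> (x T) j"
proof -
  let ?I = "integral {0..T} (\<lambda>t. exp (- lam * t) * G j (x t) a)"
  let ?m = "G j z a + p * F j z a + \<omega> \<rho> + \<bar>p\<bar> * L * \<rho>"
  have "Veps \<epsilon> x0 i0 \<le> ?I + exp (- lam * T) * Veps \<epsilon> (x T) j"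
  proof (rule field_le_epsilon)
    fix \<eta> :: real assume \<eta>: "\<eta> > 0"
    obtain \<beta> z k where tail: "solution \<epsilon> (x T) j \<beta> z k" "cost l lam \<beta> z k < Veps \<epsilon> (x T) j + \<eta>"
      using Veps_approx[OF j coh[OF T order_refl] \<epsilon> \<eta>] by blast
    obtain \<alpha>' x' i' where S: "solution \<epsilon> x0 i0 \<alpha>' x' i'"
      "cost l lam \<alpha>' x' i' = ?I + exp (- lam * T) * cost l lam \<beta> z k"
      using solution_glue[OF j a \<epsilon>(1) T x x0 coh start tail(1)] by blast
    have "Veps \<epsilon> x0 i0 \<le> ?I + exp (- lam * T) * cost l lam \<beta> z k"
      using Veps_le_cost[OF S(1) \<epsilon>(1)] S(2) by simp
    also have "\<dots> \<le> ?I + exp (- lam * T) * (Veps \<epsilon> (x T) j + \<eta>)"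
      using tail(2) by simp
    also have "\<dots> \<le> ?I + exp (- lam * T) * Veps \<epsilon> (x T) j + \<eta>"
      using \<eta> lam_pos T mult_right_mono[of "exp (- lam * T)" 1 \<eta>] by (simp add: algebra_simps)
    finally show "Veps \<epsilon> x0 i0 \<le> ?I + exp (- lam * T) * Veps \<epsilon> (x T) j + \<eta>" .
  qed
  moreover have "?I + p * (x T - x0) \<le> T * ?m"
  proof -
    have xc: "continuous_on {0..T} x" by (rule continuous_on_subset[OF ode_continuous[OF x]]) auto
    have "(\<lambda>t. exp (- lam * t) * G j (x t) a) integrable_on {0..T}"
      by (intro integrable_continuous_interval continuous_intros
          continuous_on_compose2[OF G_cont_x[OF j a, of UNIV] xc]) auto
    then have "((\<lambda>t. exp (- lam * t) * G j (x t) a + p * F j (x t) a) has_integral ?I + p * (x T - x0)) {0..T}"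
      using ode_has_integral[OF x, of 0 T] T x0
      by (intro has_integral_add has_integral_mult_right) (auto simp: integrable_integral)
    moreover have "((\<lambda>t. ?m) has_integral ?m * (T - 0)) {0..T}"
      using has_integral_const_real[of ?m 0 T] T by (simp add: mult.commute)
    ultimately have "?I + p * (x T - x0) \<le> ?m * (T - 0)"
    proof (rule has_integral_le)
      fix t assume "t \<in> {0..T}"
      then have t: "0 \<le> t" "t \<le> T" by auto
      have "exp (- lam * t) * G j (x t) a \<le> 1 * G j (x t) a"
        using t lam_pos G_nonneg[OF j a] by (intro mult_right_mono) auto
      moreover have "G j (x t) a \<le> G j z a + \<omega> \<rho>"
        using G_mod[OF j a, of "x t" z] omega_mono[OF _ near[OF t]] by simp
      moreover have "\<bar>F j (x t) a - F j z a\<bar> \<le> L * \<rho>"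
        by (rule order_trans[OF F_lip[OF j a] mult_left_mono[OF near[OF t] less_imp_le[OF L_pos]]])
      then have "\<bar>p\<bar> * \<bar>F j (x t) a - F j z a\<bar> \<le> \<bar>p\<bar> * (L * \<rho>)" by (rule mult_left_mono) simp
      then have "p * (F j (x t) a - F j z a) \<le> \<bar>p\<bar> * L * \<rho>" by (simp add: abs_mult[symmetric])
      ultimately show "exp (- lam * t) * G j (x t) a + p * F j (x t) a \<le> ?m"
        by (simp add: algebra_simps)
    qed
    then show ?thesis by (simp add: mult.commute)
  qed
  ultimately show ?thesis by linarith
qed

text \<open>
  The upper inequality along a monotone passage from \<open>y0\<close> to \<open>y1\<close> in direction \<open>s\<close>. The second
  alternative of \<open>start\<close> is a passage that begins on the threshold with the opposite output and moves
  beyond that threshold.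
\<close>

lemma Veps_travel:
  assumes j: "j \<in> {1,-1}" and a: "a \<in> A" and \<epsilon>: "\<epsilon> > 0" "L * \<epsilon> \<le> 2 * c"
    and s: "s = 1 \<or> s = -1" and d: "d > 0" and y: "s * (y1 - y0) \<ge> 0"
    and speed: "\<And>y. \<bar>y - z\<bar> \<le> \<rho> \<Longrightarrow> s * F j y a \<ge> d"
    and coh: "real_of_int j * y0 \<ge> -\<epsilon>" "real_of_int j * y1 \<ge> -\<epsilon>"
    and near: "\<bar>y0 - z\<bar> \<le> \<rho>" "\<bar>y1 - z\<bar> \<le> \<rho>"
    and start: "i0 = j \<or> i0 = -j \<and> s = real_of_int j \<and> real_of_int j * y0 = \<epsilon> \<and> y0 \<noteq> y1"
  shows "\<exists>T\<ge>0. d * T \<le> s * (y1 - y0) \<and> s * (y1 - y0) \<le> M * T \<and>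
    Veps \<epsilon> y0 i0 \<le> T * (G j z a + p * F j z a + \<omega> \<rho> + \<bar>p\<bar> * L * \<rho>) - p * (y1 - y0)
      + exp (- lam * T) * Veps \<epsilon> y1 j"
proof -
  have "\<exists>x T. 0 \<le> T \<and> d * T \<le> s * (y1 - y0) \<and> s * (y1 - y0) \<le> M * T \<and> x 0 = y0 \<and> x T = y1
     \<and> (\<forall>t\<in>{0..T}. d * t \<le> s * (x t - y0) \<and> s * (x t - y0) \<le> s * (y1 - y0))
     \<and> (\<forall>t\<ge>0. (x has_real_derivative F j (x t) a) (at t within {0..}))"
  proof (rule ode_travel[OF F_lip[OF j a] L_pos F_bound[OF j a] d s y])
    fix w assume "0 \<le> s * (w - y0)" "s * (w - y0) \<le> s * (y1 - y0)"
    then have "\<bar>w - z\<bar> \<le> \<rho>" using s near by (elim disjE) (auto simp: abs_le_iff)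
    then show "s * F j w a \<ge> d" by (rule speed)
  qed
  then obtain x T where T: "0 \<le> T" "d * T \<le> s * (y1 - y0)" "s * (y1 - y0) \<le> M * T"
    and x: "x 0 = y0" "x T = y1"
    and between: "\<And>t. 0 \<le> t \<Longrightarrow> t \<le> T \<Longrightarrow> d * t \<le> s * (x t - y0) \<and> s * (x t - y0) \<le> s * (y1 - y0)"
    and ode: "\<And>t. t \<ge> 0 \<Longrightarrow> (x has_real_derivative F j (x t) a) (at t within {0..})"
    by auto
  have btw: "0 \<le> s * (x t - y0)" "s * (x t - y0) \<le> s * (y1 - y0)" if "0 \<le> t" "t \<le> T" for t
    using between[OF that] mult_nonneg_nonneg[of d t] d that by linarith+
  have "Veps \<epsilon> y0 i0 \<le> T * (G j z a + p * F j z a + \<omega> \<rho> + \<bar>p\<bar> * L * \<rho>) - p * (x T - y0)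
    + exp (- lam * T) * Veps \<epsilon> (x T) j"
  proof (rule Veps_constant_control[OF j a \<epsilon> T(1) ode x(1)])
    fix t assume t: "0 \<le> t" "t \<le> T"
    show "real_of_int j * x t \<ge> -\<epsilon>" using btw[OF t] s j coh by (elim disjE insertE) auto
    show "\<bar>x t - z\<bar> \<le> \<rho>" using btw[OF t] s near by (elim disjE) (auto simp: abs_le_iff)
  next
    show "i0 = j \<or> i0 = -j \<and> T > 0 \<and> real_of_int i0 * y0 \<ge> -\<epsilon> \<and>
      (\<forall>t\<in>{0<..T}. \<exists>r\<in>{0<..t}. real_of_int j * x r > \<epsilon>)"
      using start
    proof
      assume st: "i0 = -j \<and> s = real_of_int j \<and> real_of_int j * y0 = \<epsilon> \<and> y0 \<noteq> y1"
      then have "T \<noteq> 0" using x by auto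
      moreover have "real_of_int j * x r > \<epsilon>" if "0 < r" "r \<le> T" for r
      proof -
        have "0 < d * r" using d that by simp
        then show ?thesis using between[of r] st that by (auto simp: right_diff_distrib)
      qed
      then have "\<exists>r\<in>{0<..t}. real_of_int j * x r > \<epsilon>" if "t \<in> {0<..T}" for t
        using that by (intro bexI[of _ t]) auto
      ultimately show ?thesis using st T(1) \<epsilon>(1) by auto
    qed simp
  qed
  then show ?thesis using T x by auto
qed

text \<open>
  Lower inequality. The bound \<open>m\<close> is required only for outputs that can occur up to time \<open>\<tau>\<close>: if
  \<open>i0 x0 > M \<tau>\<close> then the trajectory does not reach the junction and the output remains \<open>i0\<close>.
\<close>

lemma Veps_lower:
  assumes i0: "i0 \<in> {1,-1}" and x0: "real_of_int i0 * x0 \<ge> -\<epsilon>" and \<epsilon>: "\<epsilon> > 0" "L * \<epsilon> \<le> 2 * c"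
    and \<tau>: "\<tau> \<ge> 0" and \<eta>: "\<eta> > 0" and near: "\<bar>x0 - z\<bar> + M * \<tau> \<le> \<rho>"
    and m: "\<And>j a. j \<in> {1,-1} \<Longrightarrow> a \<in> A \<Longrightarrow> j = i0 \<or> real_of_int i0 * x0 \<le> M * \<tau> \<Longrightarrow> m \<le> G j z a + p * F j z a"
  shows "\<exists>y. \<exists>j\<in>{1,-1}. real_of_int j * y \<ge> -\<epsilon> \<and> \<bar>y - x0\<bar> \<le> M * \<tau> \<and>
    \<tau> * (m - \<omega> \<rho> - \<bar>p\<bar> * L * \<rho> - K * lam * \<tau>) - p * (y - x0) + exp (- lam * \<tau>) * Veps \<epsilon> y j
      \<le> Veps \<epsilon> x0 i0 + \<eta>"
proof -
  obtain \<alpha> x i where S: "solution \<epsilon> x0 i0 \<alpha> x i" and cost: "cost l lam \<alpha> x i < Veps \<epsilon> x0 i0 + \<eta>"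
    using Veps_approx[OF i0 x0 \<epsilon> \<eta>] by blast
  note D = solutionD[OF S]
  have dist: "\<bar>x t - x0\<bar> \<le> M * \<tau>" if "0 \<le> t" "t \<le> \<tau>" for t
  proof -
    have "\<bar>x t - x 0\<bar> \<le> M * \<bar>t - 0\<bar>" using solution_lip[OF S, of t 0] that by simp
    also have "\<dots> \<le> M * \<tau>" using that M_pos by (intro mult_left_mono) auto
    finally show ?thesis using D(4) by simp
  qed
  have out: "i t = i0 \<or> real_of_int i0 * x0 \<le> M * \<tau>" if "0 \<le> t" "t \<le> \<tau>" for t
  proof (rule ccontr)
    assume n: "\<not> ?thesis"
    then have "i 0 = - i t" "t \<noteq> 0" using D(5) D(7)[OF that(1)] i0 by auto
    moreover have "\<exists>r\<in>{0<..t}. real_of_int (i t) * x r > \<epsilon>" if "0 < t" "i 0 = - i t"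
      using D(6) that unfolding thermostat_iff by blast
    ultimately obtain r where r: "r \<in> {0<..t}" "real_of_int (i t) * x r > \<epsilon>"
      using \<open>0 \<le> t\<close> by fastforce
    \<comment> \<open>a switch away from \<open>i0\<close> requires the trajectory to cross the junction\<close>
    have "real_of_int i0 * x r < 0" using r(2) \<open>i 0 = - i t\<close> D(5) \<epsilon> by auto
    moreover have "\<bar>x r - x0\<bar> \<le> M * \<tau>" using dist[of r] r that by auto
    ultimately show False using n i0 by (auto simp: abs_le_iff)
  qed
  let ?g = "\<lambda>t. exp (- lam * t) * G (i t) (x t) (\<alpha> t)"
  have "?g absolutely_integrable_on {0..}"
    by (rule discounted_integrable[OF solution_running(1,2)[OF S \<epsilon>(1)] lam_pos])
  then have "?g absolutely_integrable_on {0..\<tau>}" by (rule absolutely_integrable_on_subinterval) auto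
  then have gi: "?g integrable_on {0..\<tau>}" by (simp add: absolutely_integrable_on_def)
  let ?m = "m - \<omega> \<rho> - \<bar>p\<bar> * L * \<rho> - K * lam * \<tau>"
  have int: "((\<lambda>t. ?g t + p * F (i t) (x t) (\<alpha> t)) has_integral integral {0..\<tau>} ?g + p * (x \<tau> - x0)) {0..\<tau>}"
    using gi solution_increment[OF S order_refl \<tau>] D(4)
    by (intro has_integral_add has_integral_mult_right) (auto simp: integrable_integral)
  have const: "((\<lambda>t. ?m) has_integral ?m * (\<tau> - 0)) {0..\<tau>}"
    using has_integral_const_real[of ?m 0 \<tau>] \<tau> by (simp add: mult.commute)
  have "?m * (\<tau> - 0) \<le> integral {0..\<tau>} ?g + p * (x \<tau> - x0)"
  proof (rule has_integral_le[OF const int])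
    fix t assume "t \<in> {0..\<tau>}"
    then have t: "0 \<le> t" "t \<le> \<tau>" by auto
    note j = D(7)[OF t(1)] and a = D(2)[OF t(1)]
    have nr: "\<bar>x t - z\<bar> \<le> \<rho>" using dist[OF t] near by linarith
    have "(1 - exp (- (lam * t))) * G (i t) (x t) (\<alpha> t) \<le> (lam * \<tau>) * K"
    proof (rule mult_mono)
      have "1 - exp (- (lam * t)) \<le> lam * t" using exp_neg_bounds(1)[of "lam * t"] lam_pos t by simp
      also have "\<dots> \<le> lam * \<tau>" using t lam_pos by simp
      finally show "1 - exp (- (lam * t)) \<le> lam * \<tau>" .
    qed (use G_le[OF j a] G_nonneg[OF j a] lam_pos \<tau> in auto)
    then have "G (i t) (x t) (\<alpha> t) - K * lam * \<tau> \<le> ?g t" by (simp add: algebra_simps)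
    moreover have "G (i t) z (\<alpha> t) - \<omega> \<rho> \<le> G (i t) (x t) (\<alpha> t)"
      using G_mod[OF j a, of "x t" z] omega_mono[OF _ nr] by simp
    moreover have "\<bar>F (i t) (x t) (\<alpha> t) - F (i t) z (\<alpha> t)\<bar> \<le> L * \<rho>"
      by (rule order_trans[OF F_lip[OF j a] mult_left_mono[OF nr less_imp_le[OF L_pos]]])
    then have "\<bar>p\<bar> * \<bar>F (i t) (x t) (\<alpha> t) - F (i t) z (\<alpha> t)\<bar> \<le> \<bar>p\<bar> * (L * \<rho>)" by (rule mult_left_mono) simp
    then have "- (\<bar>p\<bar> * L * \<rho>) \<le> p * (F (i t) (x t) (\<alpha> t) - F (i t) z (\<alpha> t))"
      by (simp add: abs_mult[symmetric] abs_le_iff)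
    moreover have "m \<le> G (i t) z (\<alpha> t) + p * F (i t) z (\<alpha> t)" using m[OF j a out[OF t]] .
    ultimately show "?m \<le> ?g t + p * F (i t) (x t) (\<alpha> t)" by (simp add: algebra_simps)
  qed
  then have "\<tau> * ?m \<le> integral {0..\<tau>} ?g + p * (x \<tau> - x0)" by (simp only: diff_zero mult.commute)
  moreover have "Veps \<epsilon> (x \<tau>) (i \<tau>) \<le> cost l lam (\<lambda>t. \<alpha> (\<tau> + t)) (\<lambda>t. x (\<tau> + t)) (\<lambda>t. i (\<tau> + t))"
    by (rule Veps_le_cost[OF solution_shift[OF S \<epsilon>(1) \<tau>] \<epsilon>(1)])
  then have "exp (- lam * \<tau>) * Veps \<epsilon> (x \<tau>) (i \<tau>)
      \<le> exp (- lam * \<tau>) * cost l lam (\<lambda>t. \<alpha> (\<tau> + t)) (\<lambda>t. x (\<tau> + t)) (\<lambda>t. i (\<tau> + t))"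
    by (rule mult_left_mono) simp
  ultimately have "\<tau> * ?m - p * (x \<tau> - x0) + exp (- lam * \<tau>) * Veps \<epsilon> (x \<tau>) (i \<tau>) \<le> Veps \<epsilon> x0 i0 + \<eta>"
    using cost cost_split[OF S \<epsilon>(1) \<tau>] by linarith
  then show ?thesis using D(7,8)[OF \<tau>] dist[OF \<tau> order_refl] by blast
qed

section \<open>Uniform convergence on coherent states\<close>

lemma omega_at_right_0: "k > 0 \<Longrightarrow> ((\<lambda>r. \<omega> (k * r)) \<longlongrightarrow> 0) (at_right 0)"
proof (rule filterlim_compose[OF omega_lim])
  assume "k > 0"
  then show "filterlim (\<lambda>r. k * r) (at_right 0) (at_right 0)"
    unfolding filterlim_at by (auto simp: eventually_at_filter intro!: tendsto_eq_intros)
qed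

text \<open>
  Off the junction this is the assumed uniform convergence. A coherent state \<open>(x, i)\<close> with
  \<open>i x \<le> 0\<close> is within distance \<open>2 \<epsilon>\<close> of \<open>(i \<epsilon>, i)\<close>, and by controllability the values at these two
  states differ by a quantity of order \<open>\<epsilon>\<close>.
\<close>

lemma Veps_uniform:
  assumes lim: "is_thermostatic_limit A f l lam V" and \<eta>: "\<eta> > 0"
  shows "\<forall>\<^sub>F \<epsilon> in at_right 0. \<forall>i\<in>{1,-1}. \<forall>x. real_of_int i * x \<ge> -\<epsilon> \<longrightarrow> \<bar>Veps \<epsilon> x i - V x\<bar> \<le> \<eta>"
proof -
  have unif: "\<forall>\<^sub>F \<epsilon> in at_right 0. \<forall>x\<in>UNIV - {0}. dist (V_tilde_eps A f l lam \<epsilon> x) (V x) < \<eta> / 4"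
    using lim \<eta> unfolding is_thermostatic_limit_def uniform_limit_iff
    by (elim conjE allE[of _ "\<eta> / 4"]) simp
  have "isCont V 0" using lim by (simp add: is_thermostatic_limit_def continuous_on_eq_continuous_at)
  then have "(V \<longlongrightarrow> V 0) (nhds 0)" by (simp add: isCont_def tendsto_at_iff_tendsto_nhds)
  from tendstoD[OF this, of "\<eta> / 4"] \<eta> have "\<forall>\<^sub>F x in nhds 0. dist (V x) (V 0) < \<eta> / 4" by simp
  then obtain d where d: "d > 0" "\<And>x. \<bar>x\<bar> < d \<Longrightarrow> \<bar>V x - V 0\<bar> < \<eta> / 4"
    unfolding eventually_nhds_metric by (auto simp: dist_real_def)
  have ev_d: "\<forall>\<^sub>F \<epsilon> in at_right 0. \<epsilon> < d"
    using d(1) by (intro order_tendstoD(2)[of _ 0]) (auto intro!: tendsto_eq_intros)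
  have ev_c: "\<forall>\<^sub>F \<epsilon> in at_right 0. L * \<epsilon> < c"
    using c_pos by (intro order_tendstoD(2)[of _ 0]) (auto intro!: tendsto_eq_intros)
  have "((\<lambda>\<epsilon>. 2 * \<epsilon> / c * (K + \<omega> (1 * \<epsilon>))) \<longlongrightarrow> 2 * 0 / c * (K + 0)) (at_right 0)"
    using c_pos by (intro tendsto_intros omega_at_right_0) auto
  then have ev_t: "\<forall>\<^sub>F \<epsilon> in at_right 0. 2 * \<epsilon> / c * (K + \<omega> \<epsilon>) < \<eta> / 4"
    using \<eta> by (intro order_tendstoD(2)[of _ 0]) auto
  show ?thesis
    using unif ev_d ev_c ev_t eventually_at_right_less[of "0::real"]
  proof eventually_elim
    case (elim \<epsilon>)
    then have \<epsilon>: "\<epsilon> > 0" "L * \<epsilon> \<le> 2 * c" "L * \<epsilon> \<le> c" using c_pos by auto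
    have away: "\<bar>Veps \<epsilon> x i - V x\<bar> < \<eta> / 4" if "i \<in> {1,-1}" "real_of_int i * x > 0" for i x
    proof -
      have "x \<noteq> 0" "V_tilde_eps A f l lam \<epsilon> x = Veps \<epsilon> x i" using that by (auto simp: V_tilde_eps_def)
      then show ?thesis using bspec[OF elim(1), of x] by (simp add: dist_real_def)
    qed
    have step: "Veps \<epsilon> y0 i - Veps \<epsilon> y1 i \<le> \<eta> / 4"
      if i: "i \<in> {1,-1}" and s: "s = 1 \<or> s = -1" "s * (y1 - y0) \<ge> 0" and y: "\<bar>y0\<bar> \<le> \<epsilon>" "\<bar>y1\<bar> \<le> \<epsilon>"
        "s * (y1 - y0) \<le> 2 * \<epsilon>" for i s y0 y1
    proof -
      obtain k :: int where k: "k \<in> {1,-1}" "s = real_of_int k" using s(1) by fastforce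
      obtain a where a: "a \<in> A" "s * F i 0 a \<ge> 2 * c" using control[OF i k(1)] k(2) by auto
      have speed: "s * F i z a \<ge> c" if "\<bar>z - 0\<bar> \<le> \<epsilon>" for z
      proof -
        have "\<bar>F i z a - F i 0 a\<bar> \<le> L * \<bar>z - 0\<bar>" by (rule F_lip[OF i a(1)])
        also have "\<dots> \<le> L * \<epsilon>" using that L_pos by (intro mult_left_mono) auto
        finally have "\<bar>F i z a - F i 0 a\<bar> \<le> c" using \<epsilon>(3) by linarith
        then show ?thesis using a(2) s(1) by auto
      qed
      have coh: "real_of_int i * y0 \<ge> -\<epsilon>" "real_of_int i * y1 \<ge> -\<epsilon>" using i y by auto
      have "\<exists>T\<ge>0. c * T \<le> s * (y1 - y0) \<and> s * (y1 - y0) \<le> M * T \<and>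
        Veps \<epsilon> y0 i \<le> T * (G i 0 a + 0 * F i 0 a + \<omega> \<epsilon> + \<bar>0\<bar> * L * \<epsilon>) - 0 * (y1 - y0)
          + exp (- lam * T) * Veps \<epsilon> y1 i"
        by (rule Veps_travel[OF i a(1) \<epsilon>(1,2) s(1) c_pos s(2) speed coh]) (use y in auto)
      then obtain T where T: "T \<ge> 0" "c * T \<le> s * (y1 - y0)"
        "Veps \<epsilon> y0 i \<le> T * (G i 0 a + \<omega> \<epsilon>) + exp (- lam * T) * Veps \<epsilon> y1 i" by auto
      have "T \<le> 2 * \<epsilon> / c" using T(2) y(3) c_pos by (simp add: pos_le_divide_eq mult.commute)
      then have "T * (G i 0 a + \<omega> \<epsilon>) \<le> 2 * \<epsilon> / c * (K + \<omega> \<epsilon>)"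
        using T(1) G_le[OF i a(1)] G_nonneg[OF i a(1)] omega_nonneg[of \<epsilon>] \<epsilon> by (intro mult_mono) auto
      moreover have "exp (- lam * T) * Veps \<epsilon> y1 i \<le> 1 * Veps \<epsilon> y1 i"
        using Veps_nonneg[OF i coh(2) \<epsilon>(1,2)] lam_pos T(1) by (intro mult_right_mono) auto
      ultimately show ?thesis using T(3) elim(4) by linarith
    qed
    show ?case
    proof (intro ballI allI impI)
      fix i x assume i: "i \<in> {1,-1::int}" and x: "- \<epsilon> \<le> real_of_int i * x"
      show "\<bar>Veps \<epsilon> x i - V x\<bar> \<le> \<eta>"
      proof (cases "real_of_int i * x > 0")
        case True
        then show ?thesis using away[OF i True] \<eta> by linarith
      next
        case False
        define y where "y = real_of_int i * \<epsilon>"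
        have y: "\<bar>y\<bar> \<le> \<epsilon>" "real_of_int i * y > 0" "\<bar>y\<bar> < d" using i \<epsilon> elim(2) by (auto simp: y_def)
        have xs: "\<bar>x\<bar> \<le> \<epsilon>" using i x False by auto
        have "real_of_int i = 1 \<or> real_of_int i = -1" using i by auto
        then have "Veps \<epsilon> x i - Veps \<epsilon> y i \<le> \<eta> / 4" "Veps \<epsilon> y i - Veps \<epsilon> x i \<le> \<eta> / 4"
          using step[OF i, of "real_of_int i" y x] step[OF i, of "- real_of_int i" x y] x False xs y(1) \<epsilon>(1)
          by (auto simp: y_def)
        moreover have "\<bar>Veps \<epsilon> y i - V y\<bar> < \<eta> / 4" by (rule away[OF i y(2)])
        moreover have "\<bar>V y - V 0\<bar> < \<eta> / 4" "\<bar>V x - V 0\<bar> < \<eta> / 4" using d(2) y(3) xs elim(2) by auto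
        ultimately show ?thesis by linarith
      qed
    qed
  qed
qed

lemma small_threshold:
  assumes lim: "is_thermostatic_limit A f l lam V" and \<eta>: "\<eta> > 0" and P: "\<forall>\<^sub>F \<epsilon> in at_right 0. P \<epsilon>"
  shows "\<exists>\<epsilon>>0. L * \<epsilon> \<le> 2 * c \<and> P \<epsilon> \<and>
    (\<forall>i\<in>{1,-1}. \<forall>x. real_of_int i * x \<ge> -\<epsilon> \<longrightarrow> \<bar>Veps \<epsilon> x i - V x\<bar> \<le> \<eta>)"
proof -
  have "\<forall>\<^sub>F \<epsilon> in at_right 0. L * \<epsilon> < 2 * c"
    using c_pos by (intro order_tendstoD(2)[of _ 0]) (auto intro!: tendsto_eq_intros)
  then have "\<forall>\<^sub>F \<epsilon> in at_right 0. 0 < \<epsilon> \<and> L * \<epsilon> \<le> 2 * c \<and> P \<epsilon> \<and>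
    (\<forall>i\<in>{1,-1}. \<forall>x. real_of_int i * x \<ge> -\<epsilon> \<longrightarrow> \<bar>Veps \<epsilon> x i - V x\<bar> \<le> \<eta>)"
    using Veps_uniform[OF lim \<eta>] eventually_at_right_less[of "0::real"] P
    by eventually_elim simp
  then show ?thesis by (rule eventually_happens'[OF trivial_limit_at_right_real])
qed

lemma small_time:
  fixes err :: "real \<Rightarrow> real" and x0 d :: real
  assumes "(err \<longlongrightarrow> 0) (at_right 0)" "\<sigma> > 0" "d > 0"
  shows "\<exists>\<tau>>0. err \<tau> < \<sigma> \<and> M * \<tau> < d \<and> (x0 = 0 \<or> M * \<tau> < \<bar>x0\<bar>)"
proof -
  have small: "\<forall>\<^sub>F \<tau> in at_right 0. M * \<tau> < e" if "e > 0" for e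
    using that by (intro order_tendstoD(2)[of _ 0]) (auto intro!: tendsto_eq_intros)
  have "\<forall>\<^sub>F \<tau> in at_right 0. x0 = 0 \<or> M * \<tau> < \<bar>x0\<bar>"
    using small[of "\<bar>x0\<bar>"] by (cases "x0 = 0") auto
  moreover have "\<forall>\<^sub>F \<tau> in at_right 0. err \<tau> < \<sigma>" using assms by (intro order_tendstoD(2)[of _ 0])
  ultimately have "\<forall>\<^sub>F \<tau> in at_right 0. 0 < \<tau> \<and> err \<tau> < \<sigma> \<and> M * \<tau> < d \<and> (x0 = 0 \<or> M * \<tau> < \<bar>x0\<bar>)"
    using small[OF assms(3)] eventually_at_right_less[of "0::real"] by eventually_elim simp
  then show ?thesis by (rule eventually_happens'[OF trivial_limit_at_right_real])
qed

section \<open>Viscosity inequalities for sub- and superdifferentials\<close>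

text \<open>
  A slope \<open>p\<close> in the subdifferential of \<open>V\<close> at \<open>x0\<close> cannot violate the supersolution inequality strictly on
  all relevant branches, which are both branches if \<open>x0 = 0\<close>.
\<close>

lemma supersolution_contradiction:
  assumes lim: "is_thermostatic_limit A f l lam V" and i0: "i0 \<in> {1,-1}" and x0: "real_of_int i0 * x0 \<ge> 0"
    and p: "\<And>\<kappa>. \<kappa> > 0 \<Longrightarrow> \<forall>\<^sub>F y in nhds x0. V x0 + p * (y - x0) - \<kappa> * \<bar>y - x0\<bar> \<le> V y"
    and \<sigma>: "\<sigma> > 0"
    and m: "\<And>j a. j \<in> {1,-1} \<Longrightarrow> a \<in> A \<Longrightarrow> j = i0 \<or> x0 = 0 \<Longrightarrow>
      lam * V x0 + \<sigma> \<le> G j x0 a + p * F j x0 a"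
  shows False
proof -
  \<comment> \<open>with this choice the errors below sum up to less than \<open>\<sigma> \<tau>\<close>\<close>
  define \<kappa> where "\<kappa> = \<sigma> / (4 * M)"
  have \<kappa>: "\<kappa> > 0" "\<kappa> * M = \<sigma> / 4" using \<sigma> M_pos by (auto simp: \<kappa>_def)
  obtain d where d: "d > 0" "\<And>y. \<bar>y - x0\<bar> < d \<Longrightarrow> V x0 + p * (y - x0) - \<kappa> * \<bar>y - x0\<bar> \<le> V y"
    using p[OF \<kappa>(1)] unfolding eventually_nhds_metric dist_real_def by blast
  let ?err = "\<lambda>\<tau>. \<omega> (M * \<tau>) + \<bar>p\<bar> * L * (M * \<tau>) + K * lam * \<tau> + \<bar>p\<bar> * M * lam * \<tau> + \<bar>V x0\<bar> * lam\<^sup>2 * \<tau>"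
  have "(?err \<longlongrightarrow> 0 + \<bar>p\<bar> * L * (M * 0) + K * lam * 0 + \<bar>p\<bar> * M * lam * 0 + \<bar>V x0\<bar> * lam\<^sup>2 * 0) (at_right 0)"
    by (intro tendsto_intros omega_at_right_0 M_pos)
  then have "(?err \<longlongrightarrow> 0) (at_right 0)" by simp
  then obtain \<tau> where \<tau>: "?err \<tau> < \<sigma> / 4" "M * \<tau> < d" "x0 = 0 \<or> M * \<tau> < \<bar>x0\<bar>" "\<tau> > 0"
    using small_time[of ?err "\<sigma> / 4" d x0] \<sigma> d(1) by auto
  define \<eta> where "\<eta> = \<sigma> * \<tau> / 16"
  have \<eta>: "\<eta> > 0" using \<sigma> \<tau> by (simp add: \<eta>_def)
  obtain \<epsilon> where U: "\<And>i x. i \<in> {1,-1} \<Longrightarrow> real_of_int i * x \<ge> -\<epsilon> \<Longrightarrow> \<bar>Veps \<epsilon> x i - V x\<bar> \<le> \<eta>"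
      and \<epsilon>: "L * \<epsilon> \<le> 2 * c" "0 < \<epsilon>"
    using small_threshold[OF lim \<eta> eventually_True] by blast
  have coh: "real_of_int i0 * x0 \<ge> -\<epsilon>" using x0 \<epsilon> by linarith
  have "\<exists>y. \<exists>j\<in>{1,-1}. real_of_int j * y \<ge> -\<epsilon> \<and> \<bar>y - x0\<bar> \<le> M * \<tau> \<and>
    \<tau> * ((lam * V x0 + \<sigma>) - \<omega> (M * \<tau>) - \<bar>p\<bar> * L * (M * \<tau>) - K * lam * \<tau>) - p * (y - x0)
      + exp (- lam * \<tau>) * Veps \<epsilon> y j \<le> Veps \<epsilon> x0 i0 + \<eta>"
  proof (rule Veps_lower[OF i0 coh \<epsilon>(2,1) _ \<eta>])
    fix j a assume j: "j \<in> {1,-1}" "a \<in> A" "j = i0 \<or> real_of_int i0 * x0 \<le> M * \<tau>"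
    moreover have "x0 = 0" if "real_of_int i0 * x0 \<le> M * \<tau>"
    proof -
      have "\<bar>x0\<bar> = real_of_int i0 * x0" using x0 i0 by auto
      with that \<tau>(3) show ?thesis by linarith
    qed
    ultimately show "lam * V x0 + \<sigma> \<le> G j x0 a + p * F j x0 a" by (intro m) auto
  qed (use \<tau> in auto)
  then obtain y j where j: "j \<in> {1,-1}" "real_of_int j * y \<ge> -\<epsilon>" and y: "\<bar>y - x0\<bar> \<le> M * \<tau>" and
    main: "\<tau> * ((lam * V x0 + \<sigma>) - \<omega> (M * \<tau>) - \<bar>p\<bar> * L * (M * \<tau>) - K * lam * \<tau>) - p * (y - x0)
      + exp (- lam * \<tau>) * Veps \<epsilon> y j \<le> Veps \<epsilon> x0 i0 + \<eta>" by blast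
  define E where "E = exp (- (lam * \<tau>))"
  have E: "0 \<le> E" "E \<le> 1" using lam_pos \<tau> by (auto simp: E_def)
  define w where "w = p * (y - x0)"
  have w: "\<bar>w\<bar> \<le> \<bar>p\<bar> * (M * \<tau>)" unfolding w_def abs_mult using y by (rule mult_left_mono) simp
  have "V x0 + w - \<kappa> * \<bar>y - x0\<bar> \<le> V y" unfolding w_def using y \<tau>(2) by (intro d(2)) linarith
  moreover have "\<kappa> * \<bar>y - x0\<bar> \<le> \<kappa> * (M * \<tau>)" using \<kappa> y by (intro mult_left_mono) auto
  moreover have "\<kappa> * (M * \<tau>) = \<sigma> / 4 * \<tau>" using \<kappa>(2) by (simp add: mult.assoc[symmetric])
  ultimately have "(V x0 + w) - (\<sigma> / 4 * \<tau> + \<eta>) \<le> Veps \<epsilon> y j" using U[OF j] by linarith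
  then have "E * ((V x0 + w) - (\<sigma> / 4 * \<tau> + \<eta>)) \<le> E * Veps \<epsilon> y j" using E(1) by (rule mult_left_mono)
  moreover have "E * (\<sigma> / 4 * \<tau> + \<eta>) \<le> 1 * (\<sigma> / 4 * \<tau> + \<eta>)"
    using E \<sigma> \<tau> \<eta> by (intro mult_right_mono) auto
  ultimately have "E * (V x0 + w) - (\<sigma> / 4 * \<tau> + \<eta>) \<le> E * Veps \<epsilon> y j" by (simp add: right_diff_distrib)
  moreover have "V x0 - lam * \<tau> * V x0 + w - (\<bar>V x0\<bar> * (lam * \<tau>)\<^sup>2 + lam * \<tau> * \<bar>w\<bar>) \<le> E * (V x0 + w)"
    using discount_expand[of "lam * \<tau>" "V x0" w] lam_pos \<tau> unfolding E_def by (simp add: abs_le_iff)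
  moreover have "lam * \<tau> * \<bar>w\<bar> \<le> lam * \<tau> * (\<bar>p\<bar> * (M * \<tau>))" using w lam_pos \<tau> by (intro mult_left_mono) auto
  moreover have "Veps \<epsilon> x0 i0 \<le> V x0 + \<eta>" using U[OF i0 coh] by linarith
  moreover have "\<tau> * ((lam * V x0 + \<sigma>) - \<omega> (M * \<tau>) - \<bar>p\<bar> * L * (M * \<tau>) - K * lam * \<tau>) - w
      + E * Veps \<epsilon> y j \<le> Veps \<epsilon> x0 i0 + \<eta>"
    using main by (simp add: E_def w_def)
  ultimately have "\<tau> * ((lam * V x0 + \<sigma>) - \<omega> (M * \<tau>) - \<bar>p\<bar> * L * (M * \<tau>) - K * lam * \<tau>)
      - lam * \<tau> * V x0 - \<bar>V x0\<bar> * (lam * \<tau>)\<^sup>2 - lam * \<tau> * (\<bar>p\<bar> * (M * \<tau>)) \<le> \<sigma> / 4 * \<tau> + 3 * \<eta>"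
    by linarith
  then have "\<tau> * (\<sigma> - ?err \<tau>) \<le> \<tau> * (\<sigma> * 7 / 16)"
    by (simp add: \<eta>_def algebra_simps power2_eq_square)
  then have "\<sigma> - ?err \<tau> \<le> \<sigma> * 7 / 16" using \<tau>(4) by (simp only: mult_le_cancel_left_pos)
  with \<tau>(1) \<sigma> show False by linarith
qed

text \<open>
  The subsolution inequality for a control whose trajectory from \<open>x0\<close> remains on branch \<open>j\<close> for a short
  time. At the junction this requires that the velocity does not point out of the branch.
\<close>

lemma subsolution_one_branch:
  assumes lim: "is_thermostatic_limit A f l lam V" and j: "j \<in> {1,-1}" and x0: "real_of_int j * x0 \<ge> 0"
    and a: "a \<in> A" and inward: "real_of_int j * x0 > 0 \<or> real_of_int j * F j x0 a \<ge> 0"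
    and p: "\<And>\<kappa>. \<kappa> > 0 \<Longrightarrow> \<forall>\<^sub>F y in nhds x0. V y \<le> V x0 + p * (y - x0) + \<kappa> * \<bar>y - x0\<bar>"
  shows "lam * V x0 \<le> G j x0 a + p * F j x0 a"
proof (rule ccontr)
  define \<sigma> where "\<sigma> = lam * V x0 - (G j x0 a + p * F j x0 a)"
  assume "\<not> ?thesis"
  then have \<sigma>: "\<sigma> > 0" by (simp add: \<sigma>_def)
  \<comment> \<open>with this choice the errors below sum up to less than \<open>\<sigma> \<tau>\<close>\<close>
  define \<kappa> where "\<kappa> = \<sigma> / (4 * M)"
  have \<kappa>: "\<kappa> > 0" "\<kappa> * M = \<sigma> / 4" using \<sigma> M_pos by (auto simp: \<kappa>_def)
  obtain d where d: "d > 0" "\<And>y. \<bar>y - x0\<bar> < d \<Longrightarrow> V y \<le> V x0 + p * (y - x0) + \<kappa> * \<bar>y - x0\<bar>"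
    using p[OF \<kappa>(1)] unfolding eventually_nhds_metric dist_real_def by blast
  obtain x where x: "x 0 = x0" "\<And>t. t \<ge> 0 \<Longrightarrow> (x has_real_derivative F j (x t) a) (at t within {0..})"
    using ode_exists[OF F_lip[OF j a] L_pos F_bound[OF j a]] by blast
  let ?err = "\<lambda>\<tau>. \<omega> (M * \<tau>) + \<bar>p\<bar> * L * (M * \<tau>) + \<bar>p\<bar> * M * lam * \<tau> + \<bar>V x0\<bar> * lam\<^sup>2 * \<tau>"
  have "(?err \<longlongrightarrow> 0 + \<bar>p\<bar> * L * (M * 0) + \<bar>p\<bar> * M * lam * 0 + \<bar>V x0\<bar> * lam\<^sup>2 * 0) (at_right 0)"
    by (intro tendsto_intros omega_at_right_0 M_pos)
  then have "(?err \<longlongrightarrow> 0) (at_right 0)" by simp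
  then obtain \<tau> where \<tau>: "?err \<tau> < \<sigma> / 4" "M * \<tau> < d" "x0 = 0 \<or> M * \<tau> < \<bar>x0\<bar>" "\<tau> > 0"
    using small_time[of ?err "\<sigma> / 4" d x0] \<sigma> d(1) by auto
  have near: "\<bar>x t - x0\<bar> \<le> M * \<tau>" if t: "0 \<le> t" "t \<le> \<tau>" for t
  proof -
    obtain \<xi> where "x t - x 0 = F j (x \<xi>) a * t" using increment_eq_derivative_times[OF x(2) t(1)] by blast
    then have "\<bar>x t - x0\<bar> = \<bar>F j (x \<xi>) a\<bar> * t" using t x(1) by (simp add: abs_mult)
    also have "\<dots> \<le> M * \<tau>" using F_bound[OF j a] t M_pos by (intro mult_mono) auto
    finally show ?thesis .
  qed
  have inside: "real_of_int j * x t \<ge> 0" if t: "0 \<le> t" "t \<le> \<tau>" for t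
  proof (cases "real_of_int j * F j x0 a \<ge> 0")
    case True
    have "real_of_int j * x t \<ge> real_of_int j * x0"
      by (rule ode_barrier_sign[OF F_lip[OF j a] x(2) _ True _ t(1)]) (use j x(1) in auto)
    then show ?thesis using x0 by linarith
  next
    case False
    then have "x0 \<noteq> 0" using inward by auto
    then have "\<bar>x t - x0\<bar> < \<bar>x0\<bar>" using near[OF t] \<tau>(3) by linarith
    then show ?thesis using j x0 by auto
  qed
  define \<eta> where "\<eta> = \<sigma> * \<tau> / 16"
  have \<eta>: "\<eta> > 0" using \<sigma> \<tau> by (simp add: \<eta>_def)
  obtain \<epsilon> where U: "\<And>i x. i \<in> {1,-1} \<Longrightarrow> real_of_int i * x \<ge> -\<epsilon> \<Longrightarrow> \<bar>Veps \<epsilon> x i - V x\<bar> \<le> \<eta>"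
      and \<epsilon>: "L * \<epsilon> \<le> 2 * c" "0 < \<epsilon>"
    using small_threshold[OF lim \<eta> eventually_True] by blast
  have coh: "real_of_int j * x t \<ge> -\<epsilon>" if "0 \<le> t" "t \<le> \<tau>" for t using inside[OF that] \<epsilon> by linarith
  have main: "Veps \<epsilon> x0 j \<le> \<tau> * (G j x0 a + p * F j x0 a + \<omega> (M * \<tau>) + \<bar>p\<bar> * L * (M * \<tau>)) - p * (x \<tau> - x0)
    + exp (- lam * \<tau>) * Veps \<epsilon> (x \<tau>) j"
    by (rule Veps_constant_control[OF j a \<epsilon>(2,1) _ x(2,1) coh _ near]) (use \<tau> in auto)
  define y where "y = x \<tau>"
  have y: "\<bar>y - x0\<bar> \<le> M * \<tau>" unfolding y_def using near \<tau> by auto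
  define E where "E = exp (- (lam * \<tau>))"
  have E: "0 \<le> E" "E \<le> 1" using lam_pos \<tau> by (auto simp: E_def)
  define w where "w = p * (y - x0)"
  have w: "\<bar>w\<bar> \<le> \<bar>p\<bar> * (M * \<tau>)" unfolding w_def abs_mult using y by (rule mult_left_mono) simp
  have "V y \<le> V x0 + w + \<kappa> * \<bar>y - x0\<bar>" unfolding w_def using y \<tau>(2) by (intro d(2)) linarith
  moreover have "\<kappa> * \<bar>y - x0\<bar> \<le> \<kappa> * (M * \<tau>)" using \<kappa> y by (intro mult_left_mono) auto
  moreover have "\<kappa> * (M * \<tau>) = \<sigma> / 4 * \<tau>" using \<kappa>(2) by (simp add: mult.assoc[symmetric])
  moreover have "\<bar>Veps \<epsilon> y j - V y\<bar> \<le> \<eta>" unfolding y_def using coh \<tau> by (intro U j) auto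
  ultimately have "Veps \<epsilon> y j \<le> (V x0 + w) + (\<sigma> / 4 * \<tau> + \<eta>)" by linarith
  then have "E * Veps \<epsilon> y j \<le> E * ((V x0 + w) + (\<sigma> / 4 * \<tau> + \<eta>))" using E(1) by (rule mult_left_mono)
  moreover have "E * (\<sigma> / 4 * \<tau> + \<eta>) \<le> 1 * (\<sigma> / 4 * \<tau> + \<eta>)"
    using E \<sigma> \<tau> \<eta> by (intro mult_right_mono) auto
  ultimately have "E * Veps \<epsilon> y j \<le> E * (V x0 + w) + (\<sigma> / 4 * \<tau> + \<eta>)" by (simp add: distrib_left)
  moreover have "E * (V x0 + w) \<le> V x0 - lam * \<tau> * V x0 + w + (\<bar>V x0\<bar> * (lam * \<tau>)\<^sup>2 + lam * \<tau> * \<bar>w\<bar>)"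
    using discount_expand[of "lam * \<tau>" "V x0" w] lam_pos \<tau> unfolding E_def by (simp add: abs_le_iff)
  moreover have "lam * \<tau> * \<bar>w\<bar> \<le> lam * \<tau> * (\<bar>p\<bar> * (M * \<tau>))" using w lam_pos \<tau> by (intro mult_left_mono) auto
  moreover have "\<bar>Veps \<epsilon> x0 j - V x0\<bar> \<le> \<eta>" using U[OF j] x0 \<epsilon> by simp
  then have "V x0 - \<eta> \<le> Veps \<epsilon> x0 j" by linarith
  moreover have "Veps \<epsilon> x0 j \<le> \<tau> * (G j x0 a + p * F j x0 a + \<omega> (M * \<tau>) + \<bar>p\<bar> * L * (M * \<tau>)) - w
    + E * Veps \<epsilon> y j"
    using main by (simp add: E_def w_def y_def)
  ultimately have "- \<eta> \<le> \<tau> * (G j x0 a + p * F j x0 a + \<omega> (M * \<tau>) + \<bar>p\<bar> * L * (M * \<tau>)) 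
     - lam * \<tau> * V x0 + (\<bar>V x0\<bar> * (lam * \<tau>)\<^sup>2 + lam * \<tau> * (\<bar>p\<bar> * (M * \<tau>))) + (\<sigma> / 4 * \<tau> + \<eta>)"
    by linarith
  also have "G j x0 a + p * F j x0 a = lam * V x0 - \<sigma>" by (simp add: \<sigma>_def)
  finally have "\<tau> * (\<sigma> - ?err \<tau>) \<le> \<tau> * (\<sigma> * 6 / 16)"
    by (simp add: \<eta>_def algebra_simps power2_eq_square)
  then have "\<sigma> - ?err \<tau> \<le> \<sigma> * 6 / 16" using \<tau>(4) by (simp only: mult_le_cancel_left_pos)
  with \<tau>(1) \<sigma> show False by linarith
qed

text \<open>
  Controls that drive each branch strictly towards the other one cannot both violate the subsolution
  inequality at the junction. The loop of the thermostat has the states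
  \<open>(\<epsilon> + \<delta>, 1)\<close>, \<open>(-\<epsilon>, 1)\<close>, \<open>(-\<epsilon> - \<delta>, -1)\<close>, \<open>(\<epsilon>, -1)\<close>, with controls \<open>a1\<close>, \<open>am\<close>, \<open>a2\<close>, \<open>ap\<close> in this
  order. Whether \<open>p\<close> comes from a test function is irrelevant.
\<close>

lemma subsolution_loop_contradiction:
  assumes lim: "is_thermostatic_limit A f l lam V"
    and a1: "a1 \<in> A" "F 1 0 a1 < 0" and a2: "a2 \<in> A" "F (-1) 0 a2 > 0" and \<sigma>: "\<sigma> > 0"
    and gap1: "G 1 0 a1 + p * F 1 0 a1 \<le> lam * V 0 - \<sigma>"
    and gap2: "G (-1) 0 a2 + p * F (-1) 0 a2 \<le> lam * V 0 - \<sigma>"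
  shows False
proof -
  obtain ap where ap: "ap \<in> A" "F 1 0 ap \<ge> 2 * c" using control[of 1 1] by auto
  obtain am where am: "am \<in> A" "- F (-1) 0 am \<ge> 2 * c" using control[of "-1" "-1"] by auto
  define d where "d = min c (min (- F 1 0 a1 / 2) (F (-1) 0 a2 / 2))"
  have d: "d > 0" "2 * d \<le> 2 * c" "2 * d \<le> - F 1 0 a1" "2 * d \<le> F (-1) 0 a2"
    using c_pos a1 a2 by (auto simp: d_def)
  define B where "B = K + \<bar>p\<bar> * M + \<bar>lam * V 0\<bar> + \<sigma>"
  define \<eta> where "\<eta> = min 1 (\<sigma> / (16 * lam))"
  have \<eta>: "\<eta> > 0" "\<eta> \<le> 1" "lam * \<eta> \<le> \<sigma> / 16"
  proof -
    show "\<eta> > 0" "\<eta> \<le> 1" using \<sigma> lam_pos by (auto simp: \<eta>_def)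
    have "lam * \<eta> \<le> lam * (\<sigma> / (16 * lam))" using lam_pos by (intro mult_left_mono) (auto simp: \<eta>_def)
    then show "lam * \<eta> \<le> \<sigma> / 16" using lam_pos by simp
  qed
  have "(V \<longlongrightarrow> V 0) (nhds 0)"
    using lim by (simp add: is_thermostatic_limit_def continuous_on_eq_continuous_at isCont_def tendsto_at_iff_tendsto_nhds)
  from tendstoD[OF this \<eta>(1)] obtain r where r: "r > 0" "\<And>y. \<bar>y\<bar> < r \<Longrightarrow> \<bar>V y - V 0\<bar> < \<eta>"
    unfolding eventually_nhds_metric by (auto simp: dist_real_def)
  let ?P = "\<lambda>\<epsilon>. \<omega> (2 * \<epsilon>) + \<bar>p\<bar> * L * (2 * \<epsilon>) < \<sigma> / 4 \<and> L * (2 * \<epsilon>) < d \<and> \<epsilon> < 1 \<and>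
    lam\<^sup>2 * (3 * \<epsilon> / d) * (\<bar>V 0\<bar> + 2) < \<sigma> / 8 \<and> 2 * \<epsilon> * B * M < \<sigma> * d \<and> 2 * \<epsilon> < r"
  have "\<forall>\<^sub>F \<epsilon> in at_right 0. ?P \<epsilon>"
  proof (intro eventually_conj)
    have "((\<lambda>\<epsilon>. \<omega> (2 * \<epsilon>) + \<bar>p\<bar> * L * (2 * \<epsilon>)) \<longlongrightarrow> 0 + \<bar>p\<bar> * L * (2 * 0)) (at_right 0)"
      by (intro tendsto_intros omega_at_right_0) auto
    then show "\<forall>\<^sub>F \<epsilon> in at_right 0. \<omega> (2 * \<epsilon>) + \<bar>p\<bar> * L * (2 * \<epsilon>) < \<sigma> / 4"
      using \<sigma> by (intro order_tendstoD(2)[of _ 0]) auto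
    show "\<forall>\<^sub>F \<epsilon> in at_right 0. L * (2 * \<epsilon>) < d"
      using d(1) by (intro order_tendstoD(2)[of _ 0]) (auto intro!: tendsto_eq_intros)
    show "\<forall>\<^sub>F \<epsilon> in at_right 0. \<epsilon> < (1::real)"
      by (intro order_tendstoD(2)[of _ 0]) (auto intro!: tendsto_eq_intros)
    have "((\<lambda>\<epsilon>. lam\<^sup>2 * (3 * \<epsilon> / d) * (\<bar>V 0\<bar> + 2)) \<longlongrightarrow> lam\<^sup>2 * (3 * 0 / d) * (\<bar>V 0\<bar> + 2)) (at_right 0)"
      using d(1) by (intro tendsto_intros) auto
    then show "\<forall>\<^sub>F \<epsilon> in at_right 0. lam\<^sup>2 * (3 * \<epsilon> / d) * (\<bar>V 0\<bar> + 2) < \<sigma> / 8"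
      using \<sigma> by (intro order_tendstoD(2)[of _ 0]) auto
    have "((\<lambda>\<epsilon>. 2 * \<epsilon> * B * M) \<longlongrightarrow> 2 * 0 * B * M) (at_right 0)"
      by (intro tendsto_intros)
    then show "\<forall>\<^sub>F \<epsilon> in at_right 0. 2 * \<epsilon> * B * M < \<sigma> * d"
      using \<sigma> d(1) by (intro order_tendstoD(2)[of _ 0]) auto
    show "\<forall>\<^sub>F \<epsilon> in at_right 0. 2 * \<epsilon> < r"
      using r(1) by (intro order_tendstoD(2)[of _ 0]) (auto intro!: tendsto_eq_intros)
  qed
  from small_threshold[OF lim \<eta>(1) this] obtain \<epsilon> where \<epsilon>: "\<epsilon> > 0" "L * \<epsilon> \<le> 2 * c" and P: "?P \<epsilon>"
    and U: "\<And>i x. i \<in> {1,-1} \<Longrightarrow> real_of_int i * x \<ge> -\<epsilon> \<Longrightarrow> \<bar>Veps \<epsilon> x i - V x\<bar> \<le> \<eta>"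
    by blast
  \<comment> \<open>the two switching sides take a time of order \<open>\<delta>\<close>, negligible with respect to \<open>\<epsilon>\<close>\<close>
  define \<delta> where "\<delta> = \<epsilon>\<^sup>2"
  have \<delta>: "0 < \<delta>" "\<delta> \<le> \<epsilon>" using \<epsilon>(1) P by (auto simp: \<delta>_def power2_eq_square)
  \<comment> \<open>the upper inequality for one side, with the discount factor expanded; \<open>\<sigma> / 2\<close> absorbs the errors\<close>
  have seg: "\<exists>T\<ge>0. d * T \<le> s * (y1 - y0) \<and> s * (y1 - y0) \<le> M * T \<and>
      Veps \<epsilon> y0 i0 \<le> Veps \<epsilon> y1 j - p * (y1 - y0) + T * (G j 0 a + p * F j 0 a - lam * V 0 + \<sigma> / 2)"
    if j: "j \<in> {1,-1}" and a: "a \<in> A" and s: "s = 1 \<or> s = -1" and y: "0 \<le> s * (y1 - y0)" "s * (y1 - y0) \<le> 3 * \<epsilon>"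
      "\<bar>y0\<bar> \<le> 2 * \<epsilon>" "\<bar>y1\<bar> \<le> 2 * \<epsilon>"
      and coh: "real_of_int j * y0 \<ge> -\<epsilon>" "real_of_int j * y1 \<ge> -\<epsilon>" and F0: "s * F j 0 a \<ge> 2 * d"
      and start: "i0 = j \<or> i0 = -j \<and> s = real_of_int j \<and> real_of_int j * y0 = \<epsilon> \<and> y0 \<noteq> y1" for j a s y0 y1 i0
  proof -
    have speed: "s * F j z a \<ge> d" if "\<bar>z - 0\<bar> \<le> 2 * \<epsilon>" for z
    proof -
      have "\<bar>F j z a - F j 0 a\<bar> \<le> L * \<bar>z - 0\<bar>" by (rule F_lip[OF j a])
      also have "\<dots> \<le> L * (2 * \<epsilon>)" using that L_pos by (intro mult_left_mono) auto
      finally have "\<bar>F j z a - F j 0 a\<bar> \<le> d" using P by linarith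
      then show ?thesis using F0 s by auto
    qed
    have "\<exists>T\<ge>0. d * T \<le> s * (y1 - y0) \<and> s * (y1 - y0) \<le> M * T \<and>
      Veps \<epsilon> y0 i0 \<le> T * (G j 0 a + p * F j 0 a + \<omega> (2 * \<epsilon>) + \<bar>p\<bar> * L * (2 * \<epsilon>)) - p * (y1 - y0)
          + exp (- lam * T) * Veps \<epsilon> y1 j"
      by (rule Veps_travel[OF j a \<epsilon> s d(1) y(1) speed coh _ _ start]) (use y in auto)
    then obtain T where T: "T \<ge> 0" "d * T \<le> s * (y1 - y0)" "s * (y1 - y0) \<le> M * T" and
      main: "Veps \<epsilon> y0 i0 \<le> T * (G j 0 a + p * F j 0 a + \<omega> (2 * \<epsilon>) + \<bar>p\<bar> * L * (2 * \<epsilon>)) - p * (y1 - y0)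
          + exp (- lam * T) * Veps \<epsilon> y1 j" by blast
    define W where "W = Veps \<epsilon> y1 j"
    have "\<bar>V y1 - V 0\<bar> < \<eta>" using r(2)[of y1] y(4) P by linarith
    with U[OF j coh(2)] have W: "\<bar>W - V 0\<bar> \<le> 2 * \<eta>" unfolding W_def by linarith
    have Tle: "T \<le> 3 * \<epsilon> / d" using T(2) y(2) d(1) by (simp add: pos_le_divide_eq mult.commute)
    have "exp (- (lam * T)) * (W + 0) \<le> W - lam * T * W + \<bar>W\<bar> * (lam * T)\<^sup>2"
      using discount_expand[of "lam * T" W 0] lam_pos T(1) by (simp add: abs_le_iff)
    moreover have "\<bar>W\<bar> * (lam * T)\<^sup>2 \<le> T * (\<sigma> / 8)"
    proof -
      have "\<bar>W\<bar> * (lam * T)\<^sup>2 = T * (lam\<^sup>2 * T * \<bar>W\<bar>)" by (simp add: power2_eq_square algebra_simps)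
      also have "\<dots> \<le> T * (lam\<^sup>2 * (3 * \<epsilon> / d) * (\<bar>V 0\<bar> + 2))"
        using T(1) Tle W \<eta>(2) d(1) \<epsilon>(1) by (intro mult_left_mono mult_mono) auto
      also have "\<dots> \<le> T * (\<sigma> / 8)" using T(1) P by (intro mult_left_mono) auto
      finally show ?thesis .
    qed
    moreover have "- (lam * T * W) \<le> T * (- (lam * V 0) + \<sigma> / 8)"
    proof -
      have "lam * \<bar>W - V 0\<bar> \<le> lam * (2 * \<eta>)" using W lam_pos by (intro mult_left_mono) auto
      then have "lam * \<bar>W - V 0\<bar> \<le> \<sigma> / 8" using \<eta>(3) by linarith
      moreover have "- (lam * (W - V 0)) \<le> lam * \<bar>W - V 0\<bar>"
        using lam_pos mult_left_mono[of "- (W - V 0)" "\<bar>W - V 0\<bar>" lam] by (simp add: algebra_simps)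
      ultimately have "- (lam * W) \<le> - (lam * V 0) + \<sigma> / 8" by (simp add: right_diff_distrib)
      then have "T * (- (lam * W)) \<le> T * (- (lam * V 0) + \<sigma> / 8)" using T(1) by (rule mult_left_mono)
      then show ?thesis by (simp add: algebra_simps)
    qed
    moreover have "T * (G j 0 a + p * F j 0 a + \<omega> (2 * \<epsilon>) + \<bar>p\<bar> * L * (2 * \<epsilon>))
        \<le> T * (G j 0 a + p * F j 0 a + \<sigma> / 4)"
      using T(1) P by (intro mult_left_mono) auto
    moreover have "T * (G j 0 a + p * F j 0 a + \<sigma> / 4) + T * (- (lam * V 0) + \<sigma> / 8) + T * (\<sigma> / 8)
      = T * (G j 0 a + p * F j 0 a - lam * V 0 + \<sigma> / 2)" by (simp add: algebra_simps)
    moreover have "Veps \<epsilon> y0 i0 \<le> T * (G j 0 a + p * F j 0 a + \<omega> (2 * \<epsilon>) + \<bar>p\<bar> * L * (2 * \<epsilon>)) - p * (y1 - y0)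
          + exp (- (lam * T)) * (W + 0)"
      using main by (simp add: W_def)
    ultimately have "Veps \<epsilon> y0 i0 \<le> W - p * (y1 - y0) + T * (G j 0 a + p * F j 0 a - lam * V 0 + \<sigma> / 2)"
      by linarith
    then show ?thesis using T unfolding W_def by blast
  qed
  \<comment> \<open>the switching sides, on which nothing is known about the sign\<close>
  have slow: "T * (G j 0 a + p * F j 0 a - lam * V 0 + \<sigma> / 2) \<le> T * B"
    if "j \<in> {1,-1}" "a \<in> A" "T \<ge> 0" for j a T
  proof (rule mult_left_mono[OF _ that(3)])
    have "\<bar>p * F j 0 a\<bar> \<le> \<bar>p\<bar> * M" unfolding abs_mult using F_bound[OF that(1,2)] by (rule mult_left_mono) simp
    then show "G j 0 a + p * F j 0 a - lam * V 0 + \<sigma> / 2 \<le> B"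
      using G_le[OF that(1,2), of 0] \<sigma> unfolding B_def by linarith
  qed
  \<comment> \<open>the sides with a violating control\<close>
  have fast: "T * (G j 0 a + p * F j 0 a - lam * V 0 + \<sigma> / 2) \<le> - (T * (\<sigma> / 2))"
    if "G j 0 a + p * F j 0 a \<le> lam * V 0 - \<sigma>" "T \<ge> 0" for j a T
  proof -
    have "T * (G j 0 a + p * F j 0 a - lam * V 0 + \<sigma> / 2) \<le> T * (- (\<sigma> / 2))"
      using that by (intro mult_left_mono) auto
    then show ?thesis by simp
  qed
  obtain TA where TA: "TA \<ge> 0" "2 * \<epsilon> + \<delta> \<le> M * TA"
    "Veps \<epsilon> (\<epsilon> + \<delta>) 1 \<le> Veps \<epsilon> (-\<epsilon>) 1 + p * (2 * \<epsilon> + \<delta>)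
       + TA * (G 1 0 a1 + p * F 1 0 a1 - lam * V 0 + \<sigma> / 2)"
    using seg[of 1 a1 "-1" "-\<epsilon>" "\<epsilon> + \<delta>" 1] a1(1) d \<epsilon>(1) \<delta> by (auto simp: algebra_simps)
  obtain TB where TB: "TB \<ge> 0" "d * TB \<le> \<delta>"
    "Veps \<epsilon> (-\<epsilon>) 1 \<le> Veps \<epsilon> (-\<epsilon> - \<delta>) (-1) + p * \<delta>
       + TB * (G (-1) 0 am + p * F (-1) 0 am - lam * V 0 + \<sigma> / 2)"
    using seg[of "-1" am "-1" "-\<epsilon> - \<delta>" "-\<epsilon>" 1] am d \<epsilon>(1) \<delta> by (auto simp: algebra_simps)
  obtain TC where TC: "TC \<ge> 0"
    "Veps \<epsilon> (-\<epsilon> - \<delta>) (-1) \<le> Veps \<epsilon> \<epsilon> (-1) - p * (2 * \<epsilon> + \<delta>)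
       + TC * (G (-1) 0 a2 + p * F (-1) 0 a2 - lam * V 0 + \<sigma> / 2)"
    using seg[of "-1" a2 1 \<epsilon> "-\<epsilon> - \<delta>" "-1"] a2(1) d \<epsilon>(1) \<delta> by (auto simp: algebra_simps)
  obtain TD where TD: "TD \<ge> 0" "d * TD \<le> \<delta>"
    "Veps \<epsilon> \<epsilon> (-1) \<le> Veps \<epsilon> (\<epsilon> + \<delta>) 1 - p * \<delta>
       + TD * (G 1 0 ap + p * F 1 0 ap - lam * V 0 + \<sigma> / 2)"
    using seg[of 1 ap 1 "\<epsilon> + \<delta>" \<epsilon> "-1"] ap d \<epsilon>(1) \<delta> by (auto simp: algebra_simps)
  have "TC * (\<sigma> / 2) \<ge> 0" using TC(1) \<sigma> by simp
  then have "TA * (\<sigma> / 2) \<le> (TB + TD) * B"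
    using TA(3) TB(3) TC(2) TD(3) fast[OF gap1 TA(1)] fast[OF gap2 TC(1)]
      slow[of "-1" am TB] slow[of 1 ap TD] am(1) ap(1) TB(1) TD(1)
    by (simp add: distrib_right)
  moreover have "B \<ge> 0" unfolding B_def using K_nonneg M_pos \<sigma> by (intro add_nonneg_nonneg) auto
  moreover have "d * (TB + TD) \<le> 2 * \<delta>" using TB(2) TD(2) by (simp add: distrib_left)
  ultimately have 1: "d * (TA * (\<sigma> / 2)) \<le> 2 * \<delta> * B"
  proof -
    assume *: "TA * (\<sigma> / 2) \<le> (TB + TD) * B" "0 \<le> B" "d * (TB + TD) \<le> 2 * \<delta>"
    have "d * (TA * (\<sigma> / 2)) \<le> d * ((TB + TD) * B)" using * d(1) by (intro mult_left_mono) auto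
    also have "\<dots> = (d * (TB + TD)) * B" by simp
    also have "\<dots> \<le> 2 * \<delta> * B" using * by (intro mult_right_mono) auto
    finally show ?thesis .
  qed
  have "(2 * \<epsilon>) * (d * (\<sigma> / 2)) \<le> (M * TA) * (d * (\<sigma> / 2))"
    using TA(2) \<delta>(1) d(1) \<sigma> by (intro mult_right_mono) auto
  also have "\<dots> = M * (d * (TA * (\<sigma> / 2)))" by simp
  also have "\<dots> \<le> M * (2 * \<delta> * B)" using 1 M_pos by (intro mult_left_mono) auto
  also have "\<dots> = \<epsilon> * (2 * \<epsilon> * B * M)" by (simp add: \<delta>_def power2_eq_square)
  also have "\<dots> < \<epsilon> * (\<sigma> * d)" using P \<epsilon>(1) by (intro mult_strict_left_mono) auto
  finally show False by (simp add: algebra_simps)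
qed

section \<open>Conclusion\<close>

lemma hamiltonian_bdd:
  assumes i: "i \<in> {1,-1}" and x: "x \<in> branch i"
  shows "bdd_above ((\<lambda>a. - f i x a * p - l i x a) ` A)" "A \<noteq> {}"
proof -
  have ext: "F i x a = f i x a" "G i x a = l i x a" for a
    using i x by (auto simp: const_ext_def branch_def)
  show "bdd_above ((\<lambda>a. - f i x a * p - l i x a) ` A)"
  proof (rule bdd_aboveI[of _ "M * \<bar>p\<bar>"])
    fix v assume "v \<in> (\<lambda>a. - f i x a * p - l i x a) ` A"
    then obtain a where a: "a \<in> A" "v = - f i x a * p - l i x a" by blast
    have "\<bar>f i x a * p\<bar> \<le> M * \<bar>p\<bar>"
      unfolding abs_mult using F_bound[OF i a(1), of x] ext by (intro mult_right_mono) auto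
    then show "v \<le> M * \<bar>p\<bar>" using G_nonneg[OF i a(1), of x] ext a(2) by (auto simp: abs_le_iff)
  qed
  show "A \<noteq> {}" using control[of 1 1] by auto
qed

lemma hamiltonian_le_iff:
  assumes i: "i \<in> {1,-1}" and x: "x \<in> branch i"
  shows "hamiltonian A f l i x p \<le> m \<longleftrightarrow> (\<forall>a\<in>A. - m \<le> G i x a + p * F i x a)"
proof -
  have ext: "F i x a = f i x a" "G i x a = l i x a" for a
    using i x by (auto simp: const_ext_def branch_def)
  have "hamiltonian A f l i x p \<le> m \<longleftrightarrow> (\<forall>a\<in>A. - f i x a * p - l i x a \<le> m)"
    unfolding hamiltonian_def by (rule cSUP_le_iff[OF hamiltonian_bdd(2)[OF i x] hamiltonian_bdd(1)[OF i x]])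
  also have "\<dots> \<longleftrightarrow> (\<forall>a\<in>A. - m \<le> G i x a + p * F i x a)"
    unfolding ext by (intro ball_cong refl) (auto simp: algebra_simps)
  finally show ?thesis .
qed

lemma subsolution_condition:
  assumes lim: "is_thermostatic_limit A f l lam V"
    and p: "\<And>\<kappa>. \<kappa> > 0 \<Longrightarrow> \<forall>\<^sub>F y in nhds x0. V y \<le> V x0 + p * (y - x0) + \<kappa> * \<bar>y - x0\<bar>"
    and i: "i \<in> {1,-1}" and x0: "real_of_int i * x0 > 0"
  shows "lam * V x0 + hamiltonian A f l i x0 p \<le> 0"
proof -
  have br: "x0 \<in> branch i" using i x0 by (auto simp: branch_def)
  have "lam * V x0 \<le> G i x0 a + p * F i x0 a" if "a \<in> A" for a
    using subsolution_one_branch[OF lim i _ that _ p] x0 by simp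
  then have "hamiltonian A f l i x0 p \<le> - (lam * V x0)" using hamiltonian_le_iff[OF i br] by simp
  then show ?thesis by simp
qed

text \<open>
  If both inequalities fail, each branch has a violating control. By \<open>subsolution_one_branch\<close> neither
  points into its own branch, so the loop argument applies.
\<close>

lemma junction_subsolution_condition:
  assumes lim: "is_thermostatic_limit A f l lam V"
    and p: "\<And>\<kappa>. \<kappa> > 0 \<Longrightarrow> \<forall>\<^sub>F y in nhds 0. V y \<le> V 0 + p * (y - 0) + \<kappa> * \<bar>y - 0\<bar>"
  shows "lam * V 0 + hamiltonian A f l 1 0 p \<le> 0 \<or> lam * V 0 + hamiltonian A f l (-1) 0 p \<le> 0"
proof (rule ccontr)
  assume n: "\<not> ?thesis"
  have "\<exists>a\<in>A. G i 0 a + p * F i 0 a < lam * V 0" if "i \<in> {1,-1}" for i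
  proof -
    have "\<not> hamiltonian A f l i 0 p \<le> - (lam * V 0)" using n that by auto
    then show ?thesis using hamiltonian_le_iff[OF that, of 0 p "- (lam * V 0)"] by (auto simp: branch_def not_le)
  qed
  from this[of 1] this[of "-1"] obtain a1 a2 where a: "a1 \<in> A" "a2 \<in> A"
    and gap: "G 1 0 a1 + p * F 1 0 a1 < lam * V 0" "G (-1) 0 a2 + p * F (-1) 0 a2 < lam * V 0" by auto
  have "F 1 0 a1 < 0" using subsolution_one_branch[OF lim _ _ a(1) _ p, of 1] gap(1) by force
  moreover have "F (-1) 0 a2 > 0" using subsolution_one_branch[OF lim _ _ a(2) _ p, of "-1"] gap(2) by force
  moreover define \<sigma> where "\<sigma> = min (lam * V 0 - (G 1 0 a1 + p * F 1 0 a1)) (lam * V 0 - (G (-1) 0 a2 + p * F (-1) 0 a2))"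
  have "\<sigma> > 0" "G 1 0 a1 + p * F 1 0 a1 \<le> lam * V 0 - \<sigma>" "G (-1) 0 a2 + p * F (-1) 0 a2 \<le> lam * V 0 - \<sigma>"
    using gap by (auto simp: \<sigma>_def)
  ultimately show False using subsolution_loop_contradiction[OF lim a(1) _ a(2)] by blast
qed

lemma supersolution_condition:
  assumes lim: "is_thermostatic_limit A f l lam V"
    and p: "\<And>\<kappa>. \<kappa> > 0 \<Longrightarrow> \<forall>\<^sub>F y in nhds x0. V x0 + p * (y - x0) - \<kappa> * \<bar>y - x0\<bar> \<le> V y"
    and i: "i \<in> {1,-1}" and x0: "real_of_int i * x0 \<ge> 0"
  shows "\<exists>j\<in>{1,-1}. (j = i \<or> x0 = 0) \<and> lam * V x0 + hamiltonian A f l j x0 p \<ge> 0"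
proof (rule ccontr)
  assume n: "\<not> ?thesis"
  define J where "J = {j\<in>{1,-1::int}. j = i \<or> x0 = 0}"
  have J: "finite J" "J \<noteq> {}" using i by (auto simp: J_def)
  define \<sigma> where "\<sigma> = Min ((\<lambda>j. - (lam * V x0 + hamiltonian A f l j x0 p)) ` J)"
  have "\<sigma> > 0" unfolding \<sigma>_def using n J by (auto simp: J_def not_le)
  moreover have "lam * V x0 + \<sigma> \<le> G j x0 a + p * F j x0 a" if j: "j \<in> {1,-1}" "a \<in> A" "j = i \<or> x0 = 0" for j a
  proof -
    have "\<sigma> \<le> - (lam * V x0 + hamiltonian A f l j x0 p)"
      unfolding \<sigma>_def using J j by (intro Min_le) (auto simp: J_def)
    then have "hamiltonian A f l j x0 p \<le> - (lam * V x0 + \<sigma>)" by linarith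
    moreover have "x0 \<in> branch j" using j x0 i by (auto simp: branch_def)
    ultimately show ?thesis using hamiltonian_le_iff[OF j(1)] j(2) by fastforce
  qed
  ultimately show False using supersolution_contradiction[OF lim i x0 p] by blast
qed

lemma thermostatic_limit_viscosity:
  assumes lim: "is_thermostatic_limit A f l lam V"
  shows "HJB_subsolution (hamiltonian A f l) lam V \<and> HJB_supersolution (hamiltonian A f l) lam V"
proof -
  have "viscosity_subsolution {0<..} (\<lambda>x v p. lam * v + hamiltonian A f l 1 x p) V"
    unfolding viscosity_subsolution_def
    by (intro allI impI ballI subsolution_condition[OF lim superdifferential[OF _ C1_has_derivative]]) auto
  moreover have "viscosity_subsolution {..<0} (\<lambda>x v p. lam * v + hamiltonian A f l (-1) x p) V"
    unfolding viscosity_subsolution_def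
    by (intro allI impI ballI subsolution_condition[OF lim superdifferential[OF _ C1_has_derivative]]) auto
  moreover have "junction_subsolution (hamiltonian A f l) lam V"
    unfolding junction_subsolution_def min_le_iff_disj
    by (intro allI impI junction_subsolution_condition[OF lim superdifferential[OF _ C1_has_derivative]]) auto
  moreover have "viscosity_supersolution {0<..} (\<lambda>x v p. lam * v + hamiltonian A f l 1 x p) V"
    unfolding viscosity_supersolution_def
  proof (intro allI impI ballI)
    fix \<phi> x assume *: "\<phi> C1_differentiable_on {0<..}" "x \<in> {0<..}" "local_min_at (\<lambda>y. V y - \<phi> y) x"
    show "lam * V x + hamiltonian A f l 1 x (deriv \<phi> x) \<ge> 0"
      using supersolution_condition[OF lim subdifferential[OF *(3) C1_has_derivative[OF *(1,2)]], of 1] *(2)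
      by auto
  qed
  moreover have "viscosity_supersolution {..<0} (\<lambda>x v p. lam * v + hamiltonian A f l (-1) x p) V"
    unfolding viscosity_supersolution_def
  proof (intro allI impI ballI)
    fix \<phi> x assume *: "\<phi> C1_differentiable_on {..<0}" "x \<in> {..<0}" "local_min_at (\<lambda>y. V y - \<phi> y) x"
    show "lam * V x + hamiltonian A f l (-1) x (deriv \<phi> x) \<ge> 0"
      using supersolution_condition[OF lim subdifferential[OF *(3) C1_has_derivative[OF *(1,2)]], of "-1"] *(2)
      by auto
  qed
  moreover have "junction_supersolution (hamiltonian A f l) lam V"
    unfolding junction_supersolution_def le_max_iff_disj
  proof (intro allI impI)
    fix \<phi> assume "\<phi> C1_differentiable_on UNIV \<and> local_min_at (\<lambda>y. V y - \<phi> y) 0"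
    then have *: "local_min_at (\<lambda>y. V y - \<phi> y) 0" "\<phi> C1_differentiable_on UNIV" by auto
    show "lam * V 0 + hamiltonian A f l 1 0 (deriv \<phi> 0) \<ge> 0 \<or> lam * V 0 + hamiltonian A f l (-1) 0 (deriv \<phi> 0) \<ge> 0"
      using supersolution_condition[OF lim subdifferential[OF *(1) C1_has_derivative[OF *(2) UNIV_I]], of 1]
      by auto
  qed
  ultimately show ?thesis unfolding HJB_subsolution_def HJB_supersolution_def by blast
qed

end

theorem theorem3p3:
  fixes A :: "'a::metric_space set"
    and f l :: "int \<Rightarrow> real \<Rightarrow> 'a \<Rightarrow> real"
    and lam L :: real
    and \<omega> :: "real \<Rightarrow> real"
    and V :: "real \<Rightarrow> real"
  assumes compact_A: "compact A"
    and lambda_pos: "lam > 0"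
    and f_cont: "\<And>i. i \<in> {1, -1} \<Longrightarrow> continuous_on (branch i \<times> A) (\<lambda>(x, a). f i x a)"
    and f_bdd: "\<And>i. i \<in> {1, -1} \<Longrightarrow> bounded ((\<lambda>(x, a). f i x a) ` (branch i \<times> A))"
    and l_cont: "\<And>i. i \<in> {1, -1} \<Longrightarrow> continuous_on (branch i \<times> A) (\<lambda>(x, a). l i x a)"
    and l_bdd: "\<And>i. i \<in> {1, -1} \<Longrightarrow> bounded ((\<lambda>(x, a). l i x a) ` (branch i \<times> A))"
    and l_nonneg: "\<And>i x a. \<lbrakk>i \<in> {1, -1}; x \<in> branch i; a \<in> A\<rbrakk> \<Longrightarrow> l i x a \<ge> 0"
    and L_pos: "L > 0"
    and f_lipschitz: "\<And>i x y a. \<lbrakk>i \<in> {1, -1}; x \<in> branch i; y \<in> branch i; a \<in> A\<rbrakk>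
          \<Longrightarrow> \<bar>f i x a - f i y a\<bar> \<le> L * \<bar>x - y\<bar>"
    and controllability: "\<And>i. i \<in> {1, -1} \<Longrightarrow> \<exists>a\<^sub>m\<in>A. \<exists>a\<^sub>p\<in>A. f i 0 a\<^sub>m < 0 \<and> 0 < f i 0 a\<^sub>p"
    and omega_cont: "continuous_on {0..} \<omega>"
    and omega_mono: "mono_on {0..} \<omega>"
    and omega_nonneg: "\<And>r. r \<ge> 0 \<Longrightarrow> \<omega> r \<ge> 0"
    and omega_0: "\<omega> 0 = 0"
    and l_modulus: "\<And>i x y a. \<lbrakk>i \<in> {1, -1}; x \<in> branch i; y \<in> branch i; a \<in> A\<rbrakk>
          \<Longrightarrow> \<bar>l i x a - l i y a\<bar> \<le> \<omega> \<bar>x - y\<bar>"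
    and V_limit: "is_thermostatic_limit A f l lam V"
  shows "HJB_subsolution (hamiltonian A f l) lam V \<and> HJB_supersolution (hamiltonian A f l) lam V"
proof -
  \<comment> \<open>the projection onto branch \<open>i\<close>, by which \<open>const_ext\<close> is defined; it is nonexpansive\<close>
  define \<pi> where "\<pi> i x = (if i = 1 then max x 0 else min x 0)" for i :: int and x :: real
  have \<pi>: "\<pi> i x \<in> branch i" "\<bar>\<pi> i x - \<pi> i y\<bar> \<le> \<bar>x - y\<bar>" for i x y
    by (auto simp: \<pi>_def branch_def)
  have ext: "const_ext g i x a = g i (\<pi> i x) a" for g :: "int \<Rightarrow> real \<Rightarrow> 'a \<Rightarrow> real" and i x a
    by (simp add: const_ext_def \<pi>_def)
  have bound: "\<exists>N. \<forall>i\<in>{1,-1}. \<forall>x. \<forall>a\<in>A. \<bar>const_ext g i x a\<bar> \<le> N"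
    if b: "\<And>i. i \<in> {1, -1} \<Longrightarrow> bounded ((\<lambda>(x, a). g i x a) ` (branch i \<times> A))" for g
  proof -
    have "\<exists>N. \<forall>x. \<forall>a\<in>A. \<bar>const_ext g i x a\<bar> \<le> N" if i: "i \<in> {1,-1}" for i
    proof -
      obtain N where N: "\<And>v. v \<in> (\<lambda>(x, a). g i x a) ` (branch i \<times> A) \<Longrightarrow> norm v \<le> N"
        using b[OF i] unfolding bounded_iff by blast
      have "\<bar>const_ext g i x a\<bar> \<le> N" if "a \<in> A" for x a
        using N[of "const_ext g i x a"] \<pi>(1)[of i x] that unfolding ext by force
      then show ?thesis by blast
    qed
    from this[of 1] this[of "-1"] obtain N1 N2 where
      "\<forall>x. \<forall>a\<in>A. \<bar>const_ext g 1 x a\<bar> \<le> N1" "\<forall>x. \<forall>a\<in>A. \<bar>const_ext g (-1) x a\<bar> \<le> N2" by auto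
    then show ?thesis by (intro exI[of _ "max N1 N2"]) (auto simp: le_max_iff_disj)
  qed
  obtain M where M: "\<forall>i\<in>{1,-1}. \<forall>x. \<forall>a\<in>A. \<bar>const_ext f i x a\<bar> \<le> M" using bound[OF f_bdd] by blast
  obtain K where K: "\<forall>i\<in>{1,-1}. \<forall>x. \<forall>a\<in>A. \<bar>const_ext l i x a\<bar> \<le> K" using bound[OF l_bdd] by blast
  have cont: "continuous_on A (const_ext g i x)"
    if c: "continuous_on (branch i \<times> A) (\<lambda>(x, a). g i x a)" for g :: "int \<Rightarrow> real \<Rightarrow> 'a \<Rightarrow> real" and i x
  proof -
    have "continuous_on A (\<lambda>a. (\<lambda>(x, a). g i x a) (\<pi> i x, a))"
      using \<pi>(1)[of i x] by (intro continuous_on_compose2[OF c] continuous_intros) auto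
    then show ?thesis by (simp add: ext[abs_def])
  qed
  obtain m1 p1 m2 p2 where ctrl: "m1 \<in> A" "p1 \<in> A" "m2 \<in> A" "p2 \<in> A"
    "f 1 0 m1 < 0" "0 < f 1 0 p1" "f (-1) 0 m2 < 0" "0 < f (-1) 0 p2"
    using controllability[of 1] controllability[of "-1"] by auto
  define c where "c = min (min (- f 1 0 m1) (f 1 0 p1)) (min (- f (-1) 0 m2) (f (-1) 0 p2)) / 2"
  interpret thermostat_problem A f l lam L M K c \<omega>
  proof
    show "c > 0" using ctrl by (simp add: c_def)
    show "const_ext l i x a \<ge> 0" if "i \<in> {1,-1}" "a \<in> A" for i x a
      unfolding ext using l_nonneg[OF that(1) \<pi>(1) that(2)] .
    show "const_ext l i x a \<le> K" if "i \<in> {1,-1}" "a \<in> A" for i x a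
      using K that by (meson abs_le_D1)
    show "\<bar>const_ext f i x a - const_ext f i y a\<bar> \<le> L * \<bar>x - y\<bar>" if "i \<in> {1,-1}" "a \<in> A" for i x y a
    proof -
      have "\<bar>const_ext f i x a - const_ext f i y a\<bar> \<le> L * \<bar>\<pi> i x - \<pi> i y\<bar>"
        unfolding ext using f_lipschitz[OF that(1) \<pi>(1) \<pi>(1) that(2)] .
      also have "\<dots> \<le> L * \<bar>x - y\<bar>" using L_pos \<pi>(2) by (intro mult_left_mono) auto
      finally show ?thesis .
    qed
    show "\<bar>const_ext l i x a - const_ext l i y a\<bar> \<le> \<omega> \<bar>x - y\<bar>" if "i \<in> {1,-1}" "a \<in> A" for i x y a
    proof -
      have "\<bar>const_ext l i x a - const_ext l i y a\<bar> \<le> \<omega> \<bar>\<pi> i x - \<pi> i y\<bar>"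
        unfolding ext using l_modulus[OF that(1) \<pi>(1) \<pi>(1) that(2)] .
      also have "\<dots> \<le> \<omega> \<bar>x - y\<bar>" using \<pi>(2) by (intro mono_onD[OF omega_mono]) auto
      finally show ?thesis .
    qed
    show "\<omega> r \<le> \<omega> s" if "0 \<le> r" "r \<le> s" for r s using that by (intro mono_onD[OF omega_mono]) auto
    have "(\<omega> \<longlongrightarrow> \<omega> 0) (at 0 within {0..})" using omega_cont by (simp add: continuous_on_def)
    then show "(\<omega> \<longlongrightarrow> 0) (at_right 0)" unfolding omega_0 by (rule tendsto_within_subset) auto
    show "\<exists>a\<in>A. real_of_int j * const_ext f i 0 a \<ge> 2 * c" if "i \<in> {1,-1}" "j \<in> {1,-1}" for i j
    proof -
      have z: "const_ext f i 0 a = f i 0 a" for i a by (simp add: const_ext_def)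
      have "2 * c \<le> - f 1 0 m1" "2 * c \<le> f 1 0 p1" "2 * c \<le> - f (-1) 0 m2" "2 * c \<le> f (-1) 0 p2"
        by (auto simp: c_def)
      then show ?thesis unfolding z using that ctrl(1-4) by auto
    qed
  qed (use lambda_pos L_pos M cont f_cont l_cont in auto)
  show ?thesis by (rule thermostatic_limit_viscosity[OF V_limit])
qed

end
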